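(* The $f$-vector of the poset associahedron is a comparability invariant: if $P$ and $P'$ are finite connected posets, each with at least two elements, whose comparability graphs $C(P)$ and $C(P')$ are isomorphic, then the poset associahedra $\mathscr A(P)$ and $\mathscr A(P')$ have the same $f$-vector.
   Context: The comparability graph $C(P)$ of a poset $P$ is the graph whose vertices are the elements of $P$, with an edge between two distinct elements if and only if they are comparable. A poset is connected if its Hasse diagram is a connected graph. Let $P$ be a finite connected poset with at least two elements. A proper tube of $P$ is a subset $\tau \subsetneq P$ such that: $|\tau|\ge 2$; $\tau$ is convex, i.e. for all $x,z\in\tau$ and $y\in P$, $x\preceq y\preceq z$ implies $y\in\tau$; and $\tau$ is connected as an induced subgraph of the Hasse diagram of $P$. A proper tubing of $P$ is a collection $T$ of proper tubes such that (i) any two tubes $\sigma,\tau\in T$ are nested or disjoint ($\sigma\subseteq\tau$, $\tau\subseteq\sigma$, or $\sigma\cap\tau=\emptyset$), and (ii) the directed graph $D_T$ with vertex set $T$, having an edge $(\sigma,\tau)$ whenever $\sigma\cap\tau=\emptyset$ and there exist $x\in\sigma$, $y\in\tau$ with $x\prec y$, is acyclic. The empty collection is a proper tubing. The poset associahedron $\mathscr A(P)$ is the simple polytope of dimension $|P|-2$ (unique up to combinatorial equivalence; its existence is a theorem of Galashin) whose poset of nonempty faces is isomorphic to the set of proper tubings of $P$ ordered by reverse inclusion. The face corresponding to a proper tubing $T$ has codimension $|T|$. The $f$-vector of a $d$-dimensional polytope is $(f_0,\dots,f_d)$, where $f_i$ is the number of its $i$-dimensional faces. Thus for $\mathscr A(P)$,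 $f_i$ is the number of proper tubings of $P$ consisting of exactly $|P|-2-i$ tubes. *)

theory Defs
  imports "HOL-Analysis.Analysis"
begin

text \<open>
  A poset is a carrier \<open>P\<close> with a reflexive order relation \<open>r\<close> such that \<open>partial_order_on P r\<close>;
  \<open>(x, y) \<in> r\<close> reads \<open>x \<preceq> y\<close>, and \<open>r - Id\<close> is the strict order. In particular \<open>r \<subseteq> P \<times> P\<close>.
  A simple graph is a vertex set together with a symmetric irreflexive adjacency relation.
\<close>

definition comparability_graph :: "'a rel \<Rightarrow> 'a rel" where
  "comparability_graph r = {(x, y). x \<noteq> y \<and> ((x, y) \<in> r \<or> (y, x) \<in> r)}"

definition graph_isomorphic :: "'a set \<Rightarrow> 'a rel \<Rightarrow> 'b set \<Rightarrow> 'b rel \<Rightarrow> bool" where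
  "graph_isomorphic V E V' E' \<longleftrightarrow>
     (\<exists>f. bij_betw f V V' \<and> (\<forall>x\<in>V. \<forall>y\<in>V. (x, y) \<in> E \<longleftrightarrow> (f x, f y) \<in> E'))"

definition covering_relation :: "'a rel \<Rightarrow> 'a rel" where
  "covering_relation r =
     {(x, y). (x, y) \<in> r - Id \<and> (\<nexists>z. (x, z) \<in> r - Id \<and> (z, y) \<in> r - Id)}"

definition hasse_diagram :: "'a rel \<Rightarrow> 'a rel" where
  "hasse_diagram r = covering_relation r \<union> (covering_relation r)\<inverse>"

text \<open>Connectedness of the subgraph induced on \<open>S\<close>: paths must stay inside \<open>S\<close>.\<close>

definition connected_induced_subgraph :: "'a rel \<Rightarrow> 'a set \<Rightarrow> bool" where
  "connected_induced_subgraph E S \<longleftrightarrow> (\<forall>x\<in>S. \<forall>y\<in>S. (x, y) \<in> (E \<inter> S \<times> S)\<^sup>*)"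

definition finite_connected_poset :: "'a set \<Rightarrow> 'a rel \<Rightarrow> bool" where
  "finite_connected_poset P r \<longleftrightarrow>
     finite P \<and> partial_order_on P r \<and> connected_induced_subgraph (hasse_diagram r) P"

definition order_convex :: "'a set \<Rightarrow> 'a rel \<Rightarrow> 'a set \<Rightarrow> bool" where
  "order_convex P r S \<longleftrightarrow>
     (\<forall>x\<in>S. \<forall>z\<in>S. \<forall>y\<in>P. (x, y) \<in> r \<and> (y, z) \<in> r \<longrightarrow> y \<in> S)"

definition proper_tube :: "'a set \<Rightarrow> 'a rel \<Rightarrow> 'a set \<Rightarrow> bool" where
  "proper_tube P r \<tau> \<longleftrightarrow>
     \<tau> \<subset> P \<and> card \<tau> \<ge> 2 \<and> order_convex P r \<tau> \<and>
     connected_induced_subgraph (hasse_diagram r) \<tau>"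

definition tubing_digraph :: "'a rel \<Rightarrow> 'a set set \<Rightarrow> 'a set rel" where
  "tubing_digraph r T =
     {(\<sigma>, \<tau>). \<sigma> \<in> T \<and> \<tau> \<in> T \<and> \<sigma> \<inter> \<tau> = {} \<and> (\<exists>x\<in>\<sigma>. \<exists>y\<in>\<tau>. (x, y) \<in> r - Id)}"

definition proper_tubing :: "'a set \<Rightarrow> 'a rel \<Rightarrow> 'a set set \<Rightarrow> bool" where
  "proper_tubing P r T \<longleftrightarrow>
     (\<forall>\<tau>\<in>T. proper_tube P r \<tau>) \<and>
     (\<forall>\<sigma>\<in>T. \<forall>\<tau>\<in>T. \<sigma> \<subseteq> \<tau> \<or> \<tau> \<subseteq> \<sigma> \<or> \<sigma> \<inter> \<tau> = {}) \<and>
     acyclic (tubing_digraph r T)"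

text \<open>A \<open>d\<close>-dimensional polytope is simple if each vertex lies on exactly \<open>d\<close> facets.\<close>

definition simple_polytope :: "'c::euclidean_space set \<Rightarrow> bool" where
  "simple_polytope A \<longleftrightarrow>
     polytope A \<and>
     (\<forall>v. v extreme_point_of A \<longrightarrow> int (card {F. F facet_of A \<and> v \<in> F}) = aff_dim A)"

definition nonempty_faces :: "'c::euclidean_space set \<Rightarrow> 'c set set" where
  "nonempty_faces A = {F. F face_of A \<and> F \<noteq> {}}"

text \<open>
  The poset associahedron is only determined up to combinatorial equivalence, so it is a predicate
  on polytopes: \<open>A\<close> is a realization, in some Euclidean space, of the poset associahedron
  of \<open>(P, r)\<close>.
\<close>

definition poset_associahedron :: "'a set \<Rightarrow> 'a rel \<Rightarrow> 'c::euclidean_space set \<Rightarrow> bool" where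
  "poset_associahedron P r A \<longleftrightarrow>
     simple_polytope A \<and>
     aff_dim A = int (card P) - 2 \<and>
     (\<exists>\<phi>. bij_betw \<phi> (nonempty_faces A) {T. proper_tubing P r T} \<and>
        (\<forall>F\<in>nonempty_faces A. \<forall>G\<in>nonempty_faces A. F \<subseteq> G \<longleftrightarrow> \<phi> G \<subseteq> \<phi> F))"

text \<open>The list \<open>[f\<^sub>0, \<dots>, f\<^sub>d]\<close>, where \<open>d\<close> is the dimension of the (nonempty) polytope.\<close>

definition f_vector :: "'c::euclidean_space set \<Rightarrow> nat list" where
  "f_vector A = map (\<lambda>i. card {F. F face_of A \<and> aff_dim F = int i}) [0..<nat (aff_dim A + 1)]"

end

theory Submission
  imports Defs
begin

text \<open>
  The dimension of a face of a poset associahedron can be read off from the face poset: every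
  nonempty proper face is a facet of some larger face, and the proper tubings form a simplicial complex, so
  passing from a face to one of its facets adds exactly one tube. Hence the entries of the
  \<open>f\<close>-vector count the proper tubings by their number of tubes
  (\<open>f_vector_poset_associahedron\<close>), and it remains to see that these numbers depend only on the
  comparability graph. Two facts give this.

  \<^emph>\<open>Two orders with the same comparability graph are connected by flips\<close>
  (\<open>flips_if_same_comparability_graph\<close>, a theorem of Dreesen, Poguntke and Winkler). A subset \<open>S\<close>
  is autonomous if no outside element distinguishes the elements of \<open>S\<close>, and a flip reverses the
  order inside such a set. Given two orders, colour a pair of elements according to whether they
  agree on it, disagree on it, or leave it incomparable. There is no triangle with three colours,
  so by an observation of Gallai one of the three colours does not connect the ground set. Each
  case yields a partition into smaller autonomous blocks, to which induction applies.

  \<^emph>\<open>A flip of an autonomous set \<open>S\<close> preserves the number of tubings of each size\<close>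
  (\<open>card_tubings_flip\<close>). A tube that lies inside \<open>S\<close>,
  contains \<open>S\<close> or misses \<open>S\<close> is also a tube of the flipped order. Any other tube that meets \<open>S\<close>
  contains elements below \<open>S\<close> or elements above \<open>S\<close>, but not both, and its trace on \<open>S\<close> is
  accordingly a down-set or an up-set. In a tubing, the traces of the tubes of the first kind and
  the complements of the traces of the second kind form a chain of down-sets, which cuts \<open>S\<close> into
  consecutive layers. Reversing the order of the layers, while every tube keeps its part outside
  \<open>S\<close> and its number of layers, gives traces that fit the flipped order. Acyclicity survives because
  the digraph of a tubing is acyclic as soon as its restrictions to the tubes inside \<open>S\<close> and to
  the remaining tubes are (\<open>acyclic_tubing_digraph_split\<close>): the first restriction is reversed by
  the flip, the second one does not see the order inside \<open>S\<close>.
\<close>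

section \<open>Flips of autonomous subsets\<close>

definition strict_order_on :: "'a set \<Rightarrow> 'a rel \<Rightarrow> bool" where
  "strict_order_on P R \<longleftrightarrow> R \<subseteq> P \<times> P \<and> trans R \<and> irrefl R"

definition autonomous :: "'a rel \<Rightarrow> 'a set \<Rightarrow> bool" where
  "autonomous R S \<longleftrightarrow>
     (\<forall>x. x \<notin> S \<longrightarrow> (\<forall>s\<in>S. \<forall>t\<in>S. ((x, s) \<in> R \<longleftrightarrow> (x, t) \<in> R) \<and> ((s, x) \<in> R \<longleftrightarrow> (t, x) \<in> R)))"

definition flip :: "'a set \<Rightarrow> 'a rel \<Rightarrow> 'a rel" where
  "flip S R = {(x, y). if x \<in> S \<and> y \<in> S then (y, x) \<in> R else (x, y) \<in> R}"

inductive flips :: "'a set \<Rightarrow> 'a rel \<Rightarrow> 'a rel \<Rightarrow> bool" for P R where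
  flips_refl: "flips P R R"
| flips_step: "flips P R Q \<Longrightarrow> S \<subseteq> P \<Longrightarrow> autonomous Q S \<Longrightarrow> flips P R (flip S Q)"

lemma flips_trans: "flips P Q R' \<Longrightarrow> flips P R Q \<Longrightarrow> flips P R R'"
  by (induction rule: flips.induct) (auto intro: flips.intros)

lemma flip_flip [simp]: "flip S (flip S R) = R"
  by (auto simp: flip_def)

lemma comparability_graph_flip [simp]: "comparability_graph (flip S R) = comparability_graph R"
  by (auto simp: flip_def comparability_graph_def split: if_splits)

lemma autonomousI:
  assumes "\<And>x s t. x \<notin> S \<Longrightarrow> s \<in> S \<Longrightarrow> t \<in> S \<Longrightarrow> (x, s) \<in> R \<Longrightarrow> (x, t) \<in> R"
    and "\<And>x s t. x \<notin> S \<Longrightarrow> s \<in> S \<Longrightarrow> t \<in> S \<Longrightarrow> (s, x) \<in> R \<Longrightarrow> (t, x) \<in> R"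
  shows "autonomous R S"
  unfolding autonomous_def using assms by blast

lemma autonomousD:
  assumes "autonomous R S" "x \<notin> S" "s \<in> S" "t \<in> S"
  shows "(x, s) \<in> R \<Longrightarrow> (x, t) \<in> R" "(s, x) \<in> R \<Longrightarrow> (t, x) \<in> R"
  using assms unfolding autonomous_def by blast+

lemma autonomous_flip: "autonomous R S \<Longrightarrow> autonomous (flip S R) S"
  by (rule autonomousI; simp add: flip_def; metis autonomousD)

lemma strict_order_flip:
  assumes R: "strict_order_on P R" and S: "autonomous R S"
  shows "strict_order_on P (flip S R)"
proof -
  have t: "\<And>x y z. (x, y) \<in> R \<Longrightarrow> (y, z) \<in> R \<Longrightarrow> (x, z) \<in> R"
    using R by (auto simp: strict_order_on_def dest: transD)
  have irr: "\<And>x. (x, x) \<notin> R"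
    using R by (auto simp: strict_order_on_def irrefl_def)
  have in1: "\<And>x s t. x \<notin> S \<Longrightarrow> s \<in> S \<Longrightarrow> t \<in> S \<Longrightarrow> (x, s) \<in> R \<Longrightarrow> (x, t) \<in> R"
    and in2: "\<And>x s t. x \<notin> S \<Longrightarrow> s \<in> S \<Longrightarrow> t \<in> S \<Longrightarrow> (s, x) \<in> R \<Longrightarrow> (t, x) \<in> R"
    using S unfolding autonomous_def by blast+
  have "trans (flip S R)"
  proof (rule transI)
    fix x y z assume "(x, y) \<in> flip S R" "(y, z) \<in> flip S R"
    then show "(x, z) \<in> flip S R"
      unfolding flip_def
      by (cases "x \<in> S"; cases "y \<in> S"; cases "z \<in> S"; simp) (metis t irr in1 in2)+
  qed
  moreover have "irrefl (flip S R)" using irr by (auto simp: irrefl_def flip_def)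
  moreover have "flip S R \<subseteq> P \<times> P"
    using R by (auto simp: strict_order_on_def flip_def split: if_splits)
  ultimately show ?thesis by (simp add: strict_order_on_def)
qed

lemma strict_order_converse: "strict_order_on P R \<Longrightarrow> strict_order_on P (R\<inverse>)"
  by (auto simp: strict_order_on_def irrefl_def)

lemma comparability_graph_converse [simp]: "comparability_graph (R\<inverse>) = comparability_graph R"
  by (auto simp: comparability_graph_def)

lemma strict_order_restrict: "strict_order_on P R \<Longrightarrow> strict_order_on H (R \<inter> H \<times> H)"
  by (auto simp: strict_order_on_def irrefl_def trans_Restr)

lemma comparability_graph_restrict:
  "comparability_graph (R \<inter> H \<times> H) = comparability_graph R \<inter> H \<times> H"
  by (auto simp: comparability_graph_def)

text \<open>
  An autonomous subset of an autonomous block is autonomous in the whole order, so that a sequence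
  of flips of the order induced on a block can be carried out inside the ambient order. The
  inclusion \<open>Q \<subseteq> H \<times> H\<close> is carried along because the
  induction step uses it.
\<close>

lemma flips_replace_block:
  assumes "flips H (R \<inter> H \<times> H) Q" "autonomous R H" "H \<subseteq> P"
  shows "Q \<subseteq> H \<times> H \<and> flips P R (R - H \<times> H \<union> Q)"
  using assms(1)
proof (induction rule: flips.induct)
  case flips_refl
  have "R - H \<times> H \<union> R \<inter> H \<times> H = R" by blast
  then show ?case by (auto intro: flips.intros)
next
  case (flips_step Q S)
  have "autonomous (R - H \<times> H \<union> Q) S"
    unfolding autonomous_def
  proof (intro allI impI ballI)
    fix x s t assume x: "x \<notin> S" "s \<in> S" "t \<in> S"
    show "((x, s) \<in> R - H \<times> H \<union> Q) = ((x, t) \<in> R - H \<times> H \<union> Q) \<and>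
        ((s, x) \<in> R - H \<times> H \<union> Q) = ((t, x) \<in> R - H \<times> H \<union> Q)"
    proof (cases "x \<in> H")
      case True
      then show ?thesis
        using x flips_step(2,3) unfolding autonomous_def by blast
    next
      case False
      then have "((x, s) \<in> R) = ((x, t) \<in> R)" "((s, x) \<in> R) = ((t, x) \<in> R)"
        using assms(2) x flips_step(2) unfolding autonomous_def by blast+
      then show ?thesis using False flips_step.IH by blast
    qed
  qed
  then have "flips P R (flip S (R - H \<times> H \<union> Q))"
    using flips_step assms(3) by (blast intro: flips.intros)
  moreover have "flip S (R - H \<times> H \<union> Q) = R - H \<times> H \<union> flip S Q"
    using flips_step(2) flips_step.IH by (auto simp: flip_def)
  moreover have "flip S Q \<subseteq> H \<times> H"
    using flips_step(2) flips_step.IH by (auto simp: flip_def split: if_splits)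
  ultimately show ?case by simp
qed

lemma flips_replace_blocks:
  assumes "finite \<H>" "pairwise disjnt \<H>"
    and "\<And>H. H \<in> \<H> \<Longrightarrow> H \<subseteq> P \<and> autonomous R H \<and> flips H (R \<inter> H \<times> H) (Q \<inter> H \<times> H)"
  shows "flips P R (R - (\<Union>H\<in>\<H>. H \<times> H) \<union> Q \<inter> (\<Union>H\<in>\<H>. H \<times> H))"
  using assms
proof (induction \<H> rule: finite_induct)
  case empty
  then show ?case by (simp add: flips_refl)
next
  case (insert H \<H>)
  define U where "U = (\<Union>H\<in>\<H>. H \<times> H)"
  define R1 where "R1 = R - U \<union> Q \<inter> U"
  have IH: "flips P R R1"
    using insert by (simp add: pairwise_insert U_def R1_def)
  have disj: "(x, y) \<notin> U \<and> (y, x) \<notin> U" if "x \<in> H" for x y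
    using insert.prems(1) insert.hyps that by (auto simp: U_def pairwise_insert disjnt_def)
  have R1: "(x, y) \<in> R1 \<longleftrightarrow> (x, y) \<in> R" "(y, x) \<in> R1 \<longleftrightarrow> (y, x) \<in> R" if "x \<in> H" for x y
    using disj[OF that] by (auto simp: R1_def)
  have "autonomous R H" using insert.prems by simp
  then have "autonomous R1 H"
    by (intro autonomousI) (metis R1 autonomousD)+
  moreover have "R1 \<inter> H \<times> H = R \<inter> H \<times> H" by (auto simp: R1)
  ultimately have "flips P R1 (R1 - H \<times> H \<union> Q \<inter> H \<times> H)"
    using flips_replace_block[of H R1 "Q \<inter> H \<times> H" P] insert.prems by simp
  moreover have "R1 - H \<times> H \<union> Q \<inter> H \<times> H = R - (U \<union> H \<times> H) \<union> Q \<inter> (U \<union> H \<times> H)"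
    using disj by (auto simp: R1_def)
  moreover have "(\<Union>H\<in>insert H \<H>. H \<times> H) = U \<union> H \<times> H"
    by (auto simp: U_def)
  ultimately show ?case using IH flips_trans by metis
qed

text \<open>
  The common induction step of the three cases below: if the two orders coincide across the blocks
  of a partition into autonomous sets, only the induced orders on the blocks have to be adjusted,
  and these live on smaller ground sets.
\<close>

lemma flips_glue:
  assumes "finite V" and R: "strict_order_on V R" and Q: "strict_order_on V Q"
    and "comparability_graph R = comparability_graph Q"
    and \<H>: "pairwise disjnt \<H>" "\<Union>\<H> = V" "\<And>H. H \<in> \<H> \<Longrightarrow> H \<subset> V \<and> autonomous R H"
    and across: "\<And>x y. (\<nexists>H. H \<in> \<H> \<and> x \<in> H \<and> y \<in> H) \<Longrightarrow> (x, y) \<in> R \<longleftrightarrow> (x, y) \<in> Q"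
    and IH: "\<And>H R Q. H \<subset> V \<Longrightarrow> strict_order_on H R \<Longrightarrow> strict_order_on H Q \<Longrightarrow>
       comparability_graph R = comparability_graph Q \<Longrightarrow> flips H R Q"
  shows "flips V R Q"
proof -
  have fin: "finite \<H>" using \<H>(2) \<open>finite V\<close> by (metis finite_UnionD)
  have "flips V R (R - (\<Union>H\<in>\<H>. H \<times> H) \<union> Q \<inter> (\<Union>H\<in>\<H>. H \<times> H))"
  proof (rule flips_replace_blocks[OF fin \<H>(1)])
    fix H assume H: "H \<in> \<H>"
    have "flips H (R \<inter> H \<times> H) (Q \<inter> H \<times> H)"
      using IH \<H>(3)[OF H] R Q assms(4)
      by (simp add: strict_order_restrict comparability_graph_restrict)
    then show "H \<subseteq> V \<and> autonomous R H \<and> flips H (R \<inter> H \<times> H) (Q \<inter> H \<times> H)"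
      using \<H>(3)[OF H] by blast
  qed
  moreover have "R - (\<Union>H\<in>\<H>. H \<times> H) \<union> Q \<inter> (\<Union>H\<in>\<H>. H \<times> H) = Q"
  proof -
    define U where "U = (\<Union>H\<in>\<H>. H \<times> H)"
    have "(x, y) \<in> R \<longleftrightarrow> (x, y) \<in> Q" if "(x, y) \<notin> U" for x y
      by (rule across) (use that in \<open>auto simp: U_def\<close>)
    then have "R - U \<union> Q \<inter> U = Q" by auto
    then show ?thesis by (simp only: U_def)
  qed
  ultimately show ?thesis by simp
qed

section \<open>Colourings of a complete graph without rainbow triangle\<close>

text \<open>
  The last clause, applied to all orderings of a triangle, forbids three different colours. Loops
  and pairs outside \<open>V\<close> may be coloured or not, which makes the notion hereditary in \<open>V\<close>.
\<close>

definition no_rainbow :: "'a set \<Rightarrow> 'a rel \<Rightarrow> 'a rel \<Rightarrow> 'a rel \<Rightarrow> bool" where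
  "no_rainbow V D A N \<longleftrightarrow>
     sym D \<and> sym A \<and> sym N \<and> D \<inter> A = {} \<and> D \<inter> N = {} \<and> A \<inter> N = {} \<and>
     (\<forall>x\<in>V. \<forall>y\<in>V. x \<noteq> y \<longrightarrow> (x, y) \<in> D \<union> A \<union> N) \<and>
     (\<forall>x\<in>V. \<forall>y\<in>V. \<forall>z\<in>V. \<not> ((x, y) \<in> D \<and> (y, z) \<in> A \<and> (x, z) \<in> N))"

lemma no_rainbowD:
  assumes "no_rainbow V D A N"
  shows "(x, y) \<in> D \<Longrightarrow> (y, x) \<in> D" "(x, y) \<in> A \<Longrightarrow> (y, x) \<in> A" "(x, y) \<in> N \<Longrightarrow> (y, x) \<in> N"
    and "(x, y) \<in> D \<Longrightarrow> (x, y) \<notin> A" "(x, y) \<in> D \<Longrightarrow> (x, y) \<notin> N" "(x, y) \<in> A \<Longrightarrow> (x, y) \<notin> N"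
    and "x \<in> V \<Longrightarrow> y \<in> V \<Longrightarrow> x \<noteq> y \<Longrightarrow> (x, y) \<in> D \<or> (x, y) \<in> A \<or> (x, y) \<in> N"
    and "x \<in> V \<Longrightarrow> y \<in> V \<Longrightarrow> z \<in> V \<Longrightarrow> (x, y) \<in> D \<Longrightarrow> (y, z) \<in> A \<Longrightarrow> (x, z) \<notin> N"
  using assms unfolding no_rainbow_def by (auto dest: symD)

lemma no_rainbow_rotate: "no_rainbow V D A N \<Longrightarrow> no_rainbow V A N D"
  unfolding no_rainbow_def by (simp add: Int_commute Un_ac) (meson symD)

lemma no_rainbow_swap: "no_rainbow V D A N \<Longrightarrow> no_rainbow V N A D"
  unfolding no_rainbow_def by (simp add: Int_commute Un_ac) (meson symD)

lemma connected_neighbour: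
  assumes "connected_induced_subgraph E V" "v \<in> V" "w \<in> V" "w \<noteq> v"
  shows "\<exists>u\<in>V - {v}. (v, u) \<in> E"
proof -
  have "(v, w) \<in> (E \<inter> V \<times> V)\<^sup>*" using assms unfolding connected_induced_subgraph_def by blast
  then have "v = w \<or> (\<exists>u\<in>V - {v}. (v, u) \<in> E)"
    by (induction rule: rtrancl_induct) auto
  then show ?thesis using assms by blast
qed

text \<open>
  If deleting \<open>v\<close> disconnected the colour \<open>A\<close>, then \<open>v\<close> would have an \<open>A\<close>-neighbour in every
  \<open>A\<close>-component. A vertex joined to \<open>v\<close> in colour \<open>D\<close> is then joined in colour \<open>D\<close> to everything
  outside its own component, and likewise for \<open>N\<close>. Take a \<open>D\<close>-neighbour and an \<open>N\<close>-neighbour of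
  \<open>v\<close>. If they lie in different components, the edge between them would have both colours; if they
  lie in the same one, then walking from one to the other along \<open>A\<close>-edges would have to change the
  colour towards a vertex of another component, which creates a rainbow triangle.
\<close>

lemma colours_connected_delete_vertex:
  assumes col: "no_rainbow V D A N" and v: "v \<in> V" and w: "w \<in> V" "w \<noteq> v"
    and conn: "connected_induced_subgraph D V" "connected_induced_subgraph A V"
      "connected_induced_subgraph N V"
  shows "connected_induced_subgraph A (V - {v})"
proof (rule ccontr)
  let ?V = "V - {v}"
  let ?A = "A \<inter> ?V \<times> ?V"
  assume nc: "\<not> connected_induced_subgraph A ?V"
  have sym: "sym D" "sym A" "sym N" using col unfolding no_rainbow_def by auto
  have symA: "(y, x) \<in> ?A\<^sup>*" if "(x, y) \<in> ?A\<^sup>*" for x y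
  proof -
    have "sym ?A" using sym(2) by (auto simp: sym_def)
    then show ?thesis using that by (meson sym_rtrancl symD)
  qed
  have touch: "\<exists>h. (x, h) \<in> ?A\<^sup>* \<and> h \<in> ?V \<and> (h, v) \<in> A" if x: "x \<in> ?V" for x
  proof -
    have "(x, v) \<in> (A \<inter> V \<times> V)\<^sup>*"
      using conn(2) x v unfolding connected_induced_subgraph_def by blast
    then show ?thesis using x
    proof (induction rule: converse_rtrancl_induct)
      case (step x y)
      then show ?case
        by (cases "y = v") (auto intro: converse_rtrancl_into_rtrancl)
    qed simp
  qed
  \<comment> \<open>\<open>D\<close> and \<open>N\<close> play symmetric roles; \<open>E\<close> stands for either of them.\<close>
  have spread: "(u, y) \<in> E"
    if EF: "no_rainbow V E A F" and u: "u \<in> ?V" "(v, u) \<in> E" and y: "y \<in> ?V" "(u, y) \<notin> ?A\<^sup>*"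
    for E F u y
  proof -
    obtain h where h: "(y, h) \<in> ?A\<^sup>*" "h \<in> ?V" "(h, v) \<in> A" using touch y by blast
    have far: "z \<in> ?V \<and> (u, z) \<notin> A \<and> u \<noteq> z" if "(y, z) \<in> ?A\<^sup>*" for z
    proof -
      have z: "z \<in> ?V" using that y by (induction rule: rtrancl_induct) auto
      have "(u, z) \<notin> ?A\<^sup>*" using that y symA by (meson rtrancl_trans)
      then show ?thesis using z u by auto
    qed
    have "(u, h) \<in> E"
      using far[OF h(1)] u h v no_rainbowD(7)[OF EF, of u h] no_rainbowD(8)[OF EF, of u v h]
        no_rainbowD(1)[OF EF, of v u] no_rainbowD(2)[OF EF, of h v] by auto
    have "(u, z) \<in> E" if "(h, z) \<in> ?A\<^sup>*" for z
      using that
    proof (induction rule: rtrancl_induct)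
      case base show ?case by fact
    next
      case (step z z')
      have "(y, z') \<in> ?A\<^sup>*"
        using rtrancl_trans[OF h(1) rtrancl_into_rtrancl[OF step(1,2)]] .
      then have "z' \<in> ?V" "(u, z') \<notin> A" "u \<noteq> z'" using far[of z'] by auto
      moreover have "z \<in> ?V" "(z, z') \<in> A" using step by auto
      ultimately show ?case
        using step(3) u no_rainbowD(7)[OF EF, of u z'] no_rainbowD(8)[OF EF, of u z z'] by auto
    qed
    moreover have "(h, y) \<in> ?A\<^sup>*" using h symA by blast
    ultimately show ?thesis by blast
  qed
  obtain u where u: "u \<in> ?V" "(v, u) \<in> D" using connected_neighbour[OF conn(1) v w] by blast
  obtain u' where u': "u' \<in> ?V" "(v, u') \<in> N" using connected_neighbour[OF conn(3) v w] by blast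
  have col': "no_rainbow V N A D" by (rule no_rainbow_swap[OF col])
  have DN: "D \<inter> N = {}" using col by (simp add: no_rainbow_def)
  show False
  proof (cases "(u, u') \<in> ?A\<^sup>*")
    case False
    then have "(u', u) \<notin> ?A\<^sup>*" using symA by blast
    then have "(u', u) \<in> N" using spread[OF col' u' u(1)] by blast
    moreover have "(u, u') \<in> D" using spread[OF col u u'(1)] False by blast
    ultimately show False using no_rainbowD(3,5)[OF col] by blast
  next
    case True
    obtain y where y: "y \<in> ?V" "(u, y) \<notin> ?A\<^sup>*"
    proof -
      obtain a b where ab: "a \<in> ?V" "b \<in> ?V" "(a, b) \<notin> ?A\<^sup>*"
        using nc unfolding connected_induced_subgraph_def by blast
      then have "(u, a) \<notin> ?A\<^sup>* \<or> (u, b) \<notin> ?A\<^sup>*"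
        using symA[of u a] rtrancl_trans[of a u ?A b] by blast
      then show ?thesis using that ab by blast
    qed
    have far: "(z, y) \<notin> A \<and> z \<noteq> y \<and> z \<in> ?V" if "(u, z) \<in> ?A\<^sup>*" for z
    proof -
      have z: "z \<in> ?V" using that u by (induction rule: rtrancl_induct) auto
      have "(z, y) \<notin> ?A\<^sup>*" using rtrancl_trans[OF that] y(2) by blast
      then show ?thesis using z y by auto
    qed
    have "(u, y) \<in> D" using spread[OF col u y] .
    have "(z, y) \<in> D" if "(u, z) \<in> ?A\<^sup>*" for z
      using that
    proof (induction rule: rtrancl_induct)
      case base show ?case by fact
    next
      case (step z z')
      have "(z', y) \<notin> A" "z' \<noteq> y" "z' \<in> ?V"         using far[OF rtrancl_into_rtrancl[OF step(1,2)]] by auto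
      moreover have "z \<in> ?V" "(z, z') \<in> A" using step by auto
      ultimately show ?case
        using step(3) y no_rainbowD(7)[OF col, of z' y] no_rainbowD(8)[OF col, of y z z']
          no_rainbowD(1)[OF col, of z y] no_rainbowD(3)[OF col, of z' y] by auto
    qed
    then have "(u', y) \<in> D" using True by blast
    moreover have "(u', y) \<in> N"
      using spread[OF col' u' y(1)] y(2) rtrancl_trans[OF True, of y] by blast
    ultimately show False using DN by blast
  qed
qed

text \<open>
  A counterexample yields a smaller one by deleting a vertex: the colours stay connected, and at
  least two vertices remain because the deleted vertex had both a \<open>D\<close>-neighbour and an
  \<open>N\<close>-neighbour.
\<close>

lemma gallai_disconnected_colour:
  assumes "finite V" "no_rainbow V D A N" "x \<in> V" "y \<in> V" "x \<noteq> y"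
  shows "\<not> (connected_induced_subgraph D V \<and> connected_induced_subgraph A V \<and>
            connected_induced_subgraph N V)"
  using assms
proof (induction V arbitrary: x y rule: finite_psubset_induct)
  case (psubset V)
  show ?case
  proof
    assume conn: "connected_induced_subgraph D V \<and> connected_induced_subgraph A V \<and>
            connected_induced_subgraph N V"
    have col: "no_rainbow V D A N" by fact
    obtain u where u: "u \<in> V - {x}" "(x, u) \<in> D" using connected_neighbour[of D V x y] conn psubset.prems by blast
    obtain u' where u': "u' \<in> V - {x}" "(x, u') \<in> N" using connected_neighbour[of N V x y] conn psubset.prems by blast
    have "u \<noteq> u'" using u u' col unfolding no_rainbow_def by blast
    have "connected_induced_subgraph A (V - {x})"
      using colours_connected_delete_vertex[OF col, of x y] psubset.prems conn by blast
    moreover have "connected_induced_subgraph N (V - {x})"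
      using colours_connected_delete_vertex[OF no_rainbow_rotate[OF col], of x y] psubset.prems conn by blast
    moreover have "connected_induced_subgraph D (V - {x})"
      using colours_connected_delete_vertex[OF no_rainbow_rotate[OF no_rainbow_rotate[OF col]], of x y] psubset.prems conn by blast
    moreover have "no_rainbow (V - {x}) D A N" using col unfolding no_rainbow_def by (simp, blast)
    moreover have "V - {x} \<subset> V" using psubset.prems by blast
    ultimately show False
      using psubset.IH[of "V - {x}" u u'] u(1) u'(1) \<open>u \<noteq> u'\<close> by simp
  qed
qed

section \<open>Orders with the same comparability graph\<close>

text \<open>
  The blocks are the components of the graph of all pairs that the two orders direct oppositely.
  Across blocks the orders coincide. A block is autonomous: if \<open>t\<close> and \<open>t'\<close> are directed oppositely,
  then an element \<open>z\<close> on whose comparisons with \<open>t\<close> and \<open>t'\<close> the orders agree cannot lie between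
  them, and it cannot be comparable to only one of them.
\<close>

lemma flips_if_disagreement_disconnected:
  assumes fin: "finite V" and R: "strict_order_on V R" and Q: "strict_order_on V Q"
    and G: "comparability_graph R = comparability_graph Q"
    and IH: "\<And>H R Q. H \<subset> V \<Longrightarrow> strict_order_on H R \<Longrightarrow> strict_order_on H Q \<Longrightarrow>
       comparability_graph R = comparability_graph Q \<Longrightarrow> flips H R Q"
    and nc: "\<not> connected_induced_subgraph (R \<inter> Q\<inverse> \<union> R\<inverse> \<inter> Q) V"
  shows "flips V R Q"
proof -
  define D where "D = R \<inter> Q\<inverse> \<union> R\<inverse> \<inter> Q"
  define E where "E = D\<^sup>*"
  have RV: "R \<subseteq> V \<times> V" "Q \<subseteq> V \<times> V" using R Q by (auto simp: strict_order_on_def)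
  have tr: "\<And>x y z. (x, y) \<in> R \<Longrightarrow> (y, z) \<in> R \<Longrightarrow> (x, z) \<in> R"
    "\<And>x y z. (x, y) \<in> Q \<Longrightarrow> (y, z) \<in> Q \<Longrightarrow> (x, z) \<in> Q"
    using R Q by (auto simp: strict_order_on_def dest: transD)
  have irr: "\<And>x. (x, x) \<notin> R" "\<And>x. (x, x) \<notin> Q"
    using R Q by (auto simp: strict_order_on_def irrefl_def)
  have G': "(x, y) \<in> R \<or> (y, x) \<in> R \<longleftrightarrow> (x, y) \<in> Q \<or> (y, x) \<in> Q" for x y
    using G irr unfolding comparability_graph_def set_eq_iff by (cases "x = y") auto
  have asym: "\<not> ((x, y) \<in> R \<and> (y, x) \<in> R)" "\<not> ((x, y) \<in> Q \<and> (y, x) \<in> Q)" for x y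
    using tr(1)[of x y x] tr(2)[of x y x] irr by blast+
  have DV: "D \<subseteq> V \<times> V" using RV by (auto simp: D_def)
  then have "D \<inter> V \<times> V = D" by blast
  then have nc': "\<exists>a\<in>V. \<exists>b\<in>V. (a, b) \<notin> E"
    using nc unfolding connected_induced_subgraph_def D_def[symmetric] E_def by simp
  have symE: "(y, x) \<in> E" if "(x, y) \<in> E" for x y
  proof -
    have "sym D" by (auto simp: D_def sym_def)
    then show ?thesis using that unfolding E_def by (meson sym_rtrancl symD)
  qed
  have trE: "(x, z) \<in> E" if "(x, y) \<in> E" "(y, z) \<in> E" for x y z
    using that unfolding E_def by simp
  have EV: "y \<in> V" if "(x, y) \<in> E" "x \<in> V" for x y
    using that DV unfolding E_def by (induction rule: rtrancl_induct) auto
  define \<H> where "\<H> = (\<lambda>x. E `` {x}) ` V"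
  have auton: "autonomous R (E `` {x})" for x
  proof -
    have *: "((z, s) \<in> R \<longleftrightarrow> (z, t) \<in> R) \<and> ((s, z) \<in> R \<longleftrightarrow> (t, z) \<in> R)"
      if "(s, t) \<in> E" "(s, z) \<notin> E" for s t z
      using that(1) unfolding E_def
    proof (induction rule: rtrancl_induct)
      case (step t t')
      have "(s, t') \<in> D\<^sup>*" using step(1,2) by (rule rtrancl_into_rtrancl)
      then have "(t, z) \<notin> E" "(t', z) \<notin> E"
        using trE[of s t z] trE[of s t' z] step(1) that(2) unfolding E_def by blast+
      then have "(t, z) \<notin> D" "(t', z) \<notin> D" unfolding E_def by (meson r_into_rtrancl)+
      then have "((z, t) \<in> R \<longleftrightarrow> (z, t') \<in> R) \<and> ((t, z) \<in> R \<longleftrightarrow> (t', z) \<in> R)"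
        using \<open>(t, t') \<in> D\<close> G'[of t z] G'[of t' z] asym[of t t'] asym[of t z] asym[of t' z]
          tr(1)[of t z t'] tr(1)[of t' z t] tr(2)[of t z t'] tr(2)[of t' z t]
          tr(1)[of t t' z] tr(1)[of z t' t] tr(2)[of t t' z] tr(2)[of z t' t]
          tr(1)[of t' t z] tr(1)[of z t t'] tr(2)[of t' t z] tr(2)[of z t t']
        unfolding D_def Un_iff Int_iff converse_iff by argo
      then show ?case using step(3) by blast
    qed simp
    show ?thesis unfolding autonomous_def
    proof (intro allI impI ballI)
      fix z s t assume "z \<notin> E `` {x}" "s \<in> E `` {x}" "t \<in> E `` {x}"
      then show "((z, s) \<in> R) = ((z, t) \<in> R) \<and> ((s, z) \<in> R) = ((t, z) \<in> R)"
        using *[of s t z] symE[of x s] trE[of s x t] trE[of x s z] by blast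
    qed
  qed
  show ?thesis
  proof (rule flips_glue[OF fin R Q G, of \<H>])
    show "pairwise disjnt \<H>"
    proof -
      have "E `` {x} = E `` {y}" if "(x, z) \<in> E" "(y, z) \<in> E" for x y z
        using that symE[of x z] symE[of y z] trE[of x z y] trE[of y z x] trE[of x y] trE[of y x] by blast
      then show ?thesis unfolding \<H>_def pairwise_def disjnt_def by blast
    qed
    show "\<Union>\<H> = V" using EV unfolding \<H>_def by (auto simp: E_def)
    show "H \<subset> V \<and> autonomous R H" if H: "H \<in> \<H>" for H
    proof -
      obtain x where x: "x \<in> V" "H = E `` {x}" using H unfolding \<H>_def by blast
      obtain a b where "a \<in> V" "b \<in> V" "(a, b) \<notin> E" using nc' by blast
      then have "H \<noteq> V" using x(2) symE[of x a] trE[of a x b] by blast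
      then show ?thesis using x EV auton by auto
    qed
    show "(x, y) \<in> R \<longleftrightarrow> (x, y) \<in> Q" if "\<nexists>H. H \<in> \<H> \<and> x \<in> H \<and> y \<in> H" for x y
    proof (cases "x \<in> V")
      case True
      then have "(x, y) \<notin> E" using that unfolding \<H>_def E_def by blast
      then have "(x, y) \<notin> D" unfolding E_def by (meson r_into_rtrancl)
      then show ?thesis using G'[of x y] unfolding D_def by auto
    qed (use RV in auto)
  qed (use IH in blast)
qed

text \<open>
  Components of the incomparability graph are completely comparable to each other and are linearly
  ordered by each of the two orders, but possibly differently. Let \<open>C\<close> be the bottom component of
  \<open>R\<close>, and \<open>X\<close> the part that \<open>Q\<close> puts below \<open>C\<close>. In \<open>Q\<close> the set \<open>Z = C \<union> X\<close> is below everything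
  else, hence autonomous; flipping it brings \<open>C\<close> to the bottom, so that the blocks \<open>C\<close> and \<open>V - C\<close>
  are ordered as in \<open>R\<close>.
\<close>

lemma flips_if_incomparability_disconnected:
  assumes fin: "finite V" and R: "strict_order_on V R" and Q: "strict_order_on V Q"
    and G: "comparability_graph R = comparability_graph Q"
    and IH: "\<And>H R Q. H \<subset> V \<Longrightarrow> strict_order_on H R \<Longrightarrow> strict_order_on H Q \<Longrightarrow>
       comparability_graph R = comparability_graph Q \<Longrightarrow> flips H R Q"
    and nc: "\<not> connected_induced_subgraph (V \<times> V - Id - comparability_graph R) V"
  shows "flips V R Q"
proof -
  define N where "N = V \<times> V - Id - comparability_graph R"
  have RV: "R \<subseteq> V \<times> V" "Q \<subseteq> V \<times> V" using R Q by (auto simp: strict_order_on_def)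
  have tr: "\<And>x y z. (x, y) \<in> R \<Longrightarrow> (y, z) \<in> R \<Longrightarrow> (x, z) \<in> R"
    "\<And>x y z. (x, y) \<in> Q \<Longrightarrow> (y, z) \<in> Q \<Longrightarrow> (x, z) \<in> Q"
    using R Q by (auto simp: strict_order_on_def dest: transD)
  have irr: "\<And>x. (x, x) \<notin> R" "\<And>x. (x, x) \<notin> Q"
    using R Q by (auto simp: strict_order_on_def irrefl_def)
  have G': "(x, y) \<in> R \<or> (y, x) \<in> R \<longleftrightarrow> (x, y) \<in> Q \<or> (y, x) \<in> Q" for x y
    using G irr unfolding comparability_graph_def set_eq_iff by (cases "x = y") auto
  have asym: "\<not> ((x, y) \<in> R \<and> (y, x) \<in> R)" "\<not> ((x, y) \<in> Q \<and> (y, x) \<in> Q)" for x y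
    using tr(1)[of x y x] tr(2)[of x y x] irr by blast+
  have N_iff: "(x, y) \<in> N \<longleftrightarrow> x \<in> V \<and> y \<in> V \<and> x \<noteq> y \<and> (x, y) \<notin> R \<and> (y, x) \<notin> R" for x y
    by (auto simp: N_def comparability_graph_def)
  have "N \<inter> V \<times> V = N" by (auto simp: N_def)
  then obtain a b where ab: "a \<in> V" "b \<in> V" "(a, b) \<notin> N\<^sup>*"
    using nc unfolding connected_induced_subgraph_def N_def[symmetric] by auto
  have "wf R"
    using fin RV R by (intro finite_acyclic_wf)
      (auto simp: strict_order_on_def acyclic_irrefl finite_subset[OF RV(1)])
  then obtain m where m: "m \<in> V" "\<And>y. y \<in> V \<Longrightarrow> (y, m) \<notin> R" using ab(1) by (metis wfE_min)
  define C where "C = N\<^sup>* `` {m}"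
  define W where "W = V - C"
  have symN: "(y, x) \<in> N\<^sup>*" if "(x, y) \<in> N\<^sup>*" for x y
  proof -
    have "sym N" by (auto simp: N_iff sym_def)
    then show ?thesis using that by (meson sym_rtrancl symD)
  qed
  have CV: "C \<subseteq> V"
  proof
    fix y assume "y \<in> C"
    then have "(m, y) \<in> N\<^sup>*" by (simp add: C_def)
    then show "y \<in> V" using m(1) by (induction rule: rtrancl_induct) (auto simp: N_iff)
  qed
  have mC: "m \<in> C" by (simp add: C_def)
  have "W \<noteq> {}"
  proof
    assume "W = {}"
    then have "(m, a) \<in> N\<^sup>*" "(m, b) \<in> N\<^sup>*" using ab W_def C_def by auto
    then show False using ab(3) symN[of m a] rtrancl_trans[of a m N b] by blast
  qed
  have adj: "w \<in> V \<and> (c, w) \<notin> N \<and> c \<noteq> w" if "w \<in> W" "c \<in> C" for w c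
    using that unfolding W_def C_def by (auto intro: rtrancl_into_rtrancl)
  \<comment> \<open>Incomparable \<open>c\<close>, \<open>c'\<close> lie on the same side of \<open>w\<close>: otherwise \<open>w\<close> would lie between them.\<close>
  have same: "((m, w) \<in> X \<longleftrightarrow> (c, w) \<in> X) \<and> ((w, m) \<in> X \<longleftrightarrow> (w, c) \<in> X)"
    if "w \<in> W" "c \<in> C" "X = R \<or> X = Q" for w c X
  proof -
    have trX: "(x, y) \<in> X \<Longrightarrow> (y, z) \<in> X \<Longrightarrow> (x, z) \<in> X" for x y z
      using that(3) tr(1)[of x y z] tr(2)[of x y z] by blast
    have asymX: "\<not> ((x, y) \<in> X \<and> (y, x) \<in> X)" for x y
      using that(3) asym[of x y] by blast
    have comp: "(x, y) \<in> X \<or> (y, x) \<in> X \<longleftrightarrow> (x, y) \<in> R \<or> (y, x) \<in> R" for x y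
      using that(3) G'[of x y] by blast
    have "(m, c) \<in> N\<^sup>*" using that by (simp add: C_def)
    then show ?thesis
    proof (induction rule: rtrancl_induct)
      case (step c c')
      have "c \<in> C" "c' \<in> C" using step unfolding C_def by auto
      then have "c \<in> V" "c' \<in> V" "w \<in> V" "(c, w) \<notin> N" "(c', w) \<notin> N" "c \<noteq> w" "c' \<noteq> w"
        using adj that CV by auto
      then have "((c, w) \<in> X \<longleftrightarrow> (c', w) \<in> X) \<and> ((w, c) \<in> X \<longleftrightarrow> (w, c') \<in> X)"
        using \<open>(c, c') \<in> N\<close> comp[of c w] comp[of c' w] comp[of c c'] asymX[of c w] asymX[of c' w]
          trX[of c w c'] trX[of c' w c] unfolding N_iff by auto
      then show ?case using step(3) by blast
    qed simp
  qed
  have CW_R: "(c, w) \<in> R" "(w, c) \<notin> R" if "w \<in> W" "c \<in> C" for w c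
  proof -
    have "(m, w) \<in> R" "(w, m) \<notin> R"
      using adj[OF that(1) mC] m N_iff by blast+
    then show "(c, w) \<in> R" "(w, c) \<notin> R" using same[OF that] by blast+
  qed
  \<comment> \<open>By \<open>same\<close>, comparisons of \<open>W\<close> with the single element \<open>m\<close> decide those with all of \<open>C\<close>.\<close>
  define X where "X = {w \<in> W. (w, m) \<in> Q}"
  define Z where "Z = C \<union> X"
  have XQ: "(w, c) \<in> Q" "(c, w) \<notin> Q" if "w \<in> X" "c \<in> C" for w c
    using that same[of w c Q] asym[of w c] unfolding X_def by blast+
  have YQ: "(c, w) \<in> Q" "(w, c) \<notin> Q" if "w \<in> W - X" "c \<in> C" for w c
  proof -
    have "(m, w) \<in> Q" using that G'[of m w] CW_R[of w m] mC unfolding X_def by blast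
    then show "(c, w) \<in> Q" "(w, c) \<notin> Q" using that same[of w c Q] asym[of c w] by blast+
  qed
  have ZY: "(z, y) \<in> Q" "(y, z) \<notin> Q" if "z \<in> Z" "y \<in> V - Z" for z y
  proof -
    have "y \<in> W - X" using that unfolding Z_def W_def by blast
    then have y: "(m, y) \<in> Q" "z \<in> C \<Longrightarrow> (z, y) \<in> Q" using YQ[of y] mC by blast+
    have "z \<in> X \<Longrightarrow> (z, m) \<in> Q" using XQ[of z m] mC by blast
    then show "(z, y) \<in> Q" using that(1) y tr(2)[of z m y] unfolding Z_def by blast
    then show "(y, z) \<notin> Q" using asym[of y z] by blast
  qed
  have autZ: "autonomous Q Z"
  proof (rule autonomousI)
    fix x s t assume "x \<notin> Z" "s \<in> Z" "t \<in> Z"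
    then show "(x, s) \<in> Q \<Longrightarrow> (x, t) \<in> Q" "(s, x) \<in> Q \<Longrightarrow> (t, x) \<in> Q"
      using ZY[of s x] ZY[of t x] RV(2) by blast+
  qed
  have ZV: "Z \<subseteq> V" using CV unfolding Z_def X_def W_def by blast
  have "flips V R (flip Z Q)"
  proof (rule flips_glue[OF fin R strict_order_flip[OF Q autZ], of "{C, W}"])
    show "comparability_graph R = comparability_graph (flip Z Q)" using G by simp
    show "pairwise disjnt {C, W}" by (auto simp: pairwise_insert disjnt_def W_def)
    show "\<Union>{C, W} = V" using CV by (auto simp: W_def)
    show "H \<subset> V \<and> autonomous R H" if "H \<in> {C, W}" for H
    proof -
      have "autonomous R C"
      proof (rule autonomousI)
        fix x s t assume "x \<notin> C" "s \<in> C" "t \<in> C"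
        then show "(x, s) \<in> R \<Longrightarrow> (x, t) \<in> R" "(s, x) \<in> R \<Longrightarrow> (t, x) \<in> R"
          using CW_R[of x s] CW_R[of x t] RV(1) W_def by blast+
      qed
      moreover have "autonomous R W"
      proof (rule autonomousI)
        fix x s t assume "x \<notin> W" "s \<in> W" "t \<in> W"
        then show "(x, s) \<in> R \<Longrightarrow> (x, t) \<in> R" "(s, x) \<in> R \<Longrightarrow> (t, x) \<in> R"
          using CW_R[of s x] CW_R[of t x] RV(1) W_def by blast+
      qed
      moreover have "C \<subset> V" "W \<subset> V" using CV \<open>W \<noteq> {}\<close> mC W_def by auto
      ultimately show ?thesis using that by blast
    qed
    show "(x, y) \<in> R \<longleftrightarrow> (x, y) \<in> flip Z Q" if "\<nexists>H. H \<in> {C, W} \<and> x \<in> H \<and> y \<in> H" for x y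
    proof (cases "x \<in> V \<and> y \<in> V")
      case True
      have "\<not> (x \<in> C \<and> y \<in> C)" "\<not> (x \<in> W \<and> y \<in> W)" using that by auto
      then consider "x \<in> C" "y \<in> W" | "x \<in> W" "y \<in> C" using True W_def by blast
      then show ?thesis
      proof cases
        case 1
        then show ?thesis using CW_R[of y x] XQ[of y x] YQ[of y x]
          by (auto simp: flip_def Z_def W_def)
      next
        case 2
        then show ?thesis using CW_R[of x y] XQ[of x y] YQ[of x y]
          by (auto simp: flip_def Z_def W_def)
      qed
    next
      case False
      then show ?thesis using RV by (auto simp: flip_def)
    qed
  qed (use IH in blast)
  then have "flips V R (flip Z (flip Z Q))"
    using flips_step[OF _ ZV autonomous_flip[OF autZ]] by blast
  then show ?thesis by simp
qed

text \<open>
  The colours are disagreement, agreement and incomparability; a triangle with all three would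
  violate transitivity of one of the orders. If agreement is the disconnected colour, the case of
  disagreement applies to the second order reversed, and a flip of the whole ground set reverses it
  back.
\<close>

theorem flips_if_same_comparability_graph:
  assumes "finite V" "strict_order_on V R" "strict_order_on V Q"
    and "comparability_graph R = comparability_graph Q"
  shows "flips V R Q"
  using assms
proof (induction V arbitrary: R Q rule: finite_psubset_induct)
  case (psubset V)
  note fin = \<open>finite V\<close> and R = psubset.prems(1) and Q = psubset.prems(2) and G = psubset.prems(3)
  have RV: "R \<subseteq> V \<times> V" "Q \<subseteq> V \<times> V" using R Q by (auto simp: strict_order_on_def)
  have tr: "\<And>x y z. (x, y) \<in> R \<Longrightarrow> (y, z) \<in> R \<Longrightarrow> (x, z) \<in> R"
    "\<And>x y z. (x, y) \<in> Q \<Longrightarrow> (y, z) \<in> Q \<Longrightarrow> (x, z) \<in> Q"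
    using R Q by (auto simp: strict_order_on_def dest: transD)
  have irr: "\<And>x. (x, x) \<notin> R" "\<And>x. (x, x) \<notin> Q"
    using R Q by (auto simp: strict_order_on_def irrefl_def)
  have G': "(x, y) \<in> R \<or> (y, x) \<in> R \<longleftrightarrow> (x, y) \<in> Q \<or> (y, x) \<in> Q" for x y
    using G irr unfolding comparability_graph_def set_eq_iff by (cases "x = y") auto
  let ?D = "R \<inter> Q\<inverse> \<union> R\<inverse> \<inter> Q" and ?A = "R \<inter> Q \<union> R\<inverse> \<inter> Q\<inverse>"
    and ?N = "V \<times> V - Id - comparability_graph R"
  show ?case
  proof (cases "\<exists>x\<in>V. \<exists>y\<in>V. x \<noteq> y")
    case False
    have "R = {}" "Q = {}" using False RV irr by fastforce+
    then show ?thesis by (simp add: flips_refl)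
  next
    case True
    then obtain x y where xy: "x \<in> V" "y \<in> V" "x \<noteq> y" by blast
    have "no_rainbow V ?D ?A ?N"
      unfolding no_rainbow_def
    proof (intro conjI ballI impI notI)
      show "sym ?D" "sym ?A" "sym ?N" by (auto simp: sym_def comparability_graph_def)
      have asym: "\<not> ((x, y) \<in> R \<and> (y, x) \<in> R)" "\<not> ((x, y) \<in> Q \<and> (y, x) \<in> Q)" for x y
        using tr(1)[of x y x] tr(2)[of x y x] irr by blast+
      then show "?D \<inter> ?A = {}" by blast
      show "?D \<inter> ?N = {}" "?A \<inter> ?N = {}" by (auto simp: comparability_graph_def)
      show "(a, b) \<in> ?D \<union> ?A \<union> ?N" if "a \<in> V" "b \<in> V" "a \<noteq> b" for a b
        using that G'[of a b] by (auto simp: comparability_graph_def)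
      show False if "a \<in> V" "b \<in> V" "c \<in> V" "(a, b) \<in> ?D \<and> (b, c) \<in> ?A \<and> (a, c) \<in> ?N" for a b c
      proof -
        have "(a, c) \<notin> R" "(c, a) \<notin> R" "(a, c) \<notin> Q" "(c, a) \<notin> Q"
          using that G'[of a c] by (auto simp: comparability_graph_def)
        then show False
          using that tr(1)[of a b c] tr(1)[of c b a] tr(2)[of a b c] tr(2)[of c b a] by auto
      qed
    qed
    then consider "\<not> connected_induced_subgraph ?D V" | "\<not> connected_induced_subgraph ?A V"
      | "\<not> connected_induced_subgraph ?N V"
      using gallai_disconnected_colour[OF fin _ xy] by blast
    then show ?thesis
    proof cases
      case 1
      then show ?thesis
        using flips_if_disagreement_disconnected[OF fin R Q G] psubset.IH by blast
    next
      case 2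
      have "flips V R (Q\<inverse>)"
        using flips_if_disagreement_disconnected[OF fin R strict_order_converse[OF Q]]
          psubset.IH 2 G by simp
      moreover have "autonomous (Q\<inverse>) V" using RV by (auto simp: autonomous_def)
      ultimately have "flips V R (flip V (Q\<inverse>))" by (simp add: flips_step)
      moreover have "flip V (Q\<inverse>) = Q" using RV by (auto simp: flip_def)
      ultimately show ?thesis by simp
    next
      case 3
      then show ?thesis
        using flips_if_incomparability_disconnected[OF fin R Q G] psubset.IH by blast
    qed
  qed
qed

section \<open>Mirroring a chain of subsets\<close>

text \<open>
  For a chain \<open>\<C>\<close> of sets, the index of the layer between consecutive members that contains \<open>s\<close>,
  counted from the smallest member.
\<close>

definition level :: "'a set set \<Rightarrow> 'a \<Rightarrow> nat" where
  "level \<C> s = card {C \<in> \<C>. s \<notin> C}"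

text \<open>
  The union of the layers opposite to those that \<open>X\<close> meets, when a chain of \<open>n\<close> sets cuts \<open>S\<close> into
  layers \<open>0, \<dots>, n\<close> and layer \<open>i\<close> is opposite to layer \<open>n - i\<close>. Initial and final unions of layers are
  thereby exchanged in a uniform way.
\<close>

definition mirror :: "'a set \<Rightarrow> 'a set set \<Rightarrow> 'a set \<Rightarrow> 'a set" where
  "mirror S \<C> X = {s \<in> S. \<exists>x\<in>X. level \<C> s + level \<C> x = card \<C>}"

text \<open>
  Members of the chain are distinct, nonempty and different from \<open>S\<close>, hence no layer is empty.
  Removing the largest member reduces to a shorter chain inside it.
\<close>

lemma level_surjective:
  assumes "finite \<C>" "S \<noteq> {}"
    and "\<And>C. C \<in> \<C> \<Longrightarrow> C \<noteq> {} \<and> C \<subset> S"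
    and "\<And>C D. C \<in> \<C> \<Longrightarrow> D \<in> \<C> \<Longrightarrow> C \<subseteq> D \<or> D \<subseteq> C"
    and "k \<le> card \<C>"
  shows "\<exists>s\<in>S. level \<C> s = k"
  using assms
proof (induction \<C> arbitrary: S rule: finite_psubset_induct)
  case (psubset \<C>)
  show ?case
  proof (cases "\<C> = {}")
    case True
    then show ?thesis using psubset.prems by (auto simp: level_def)
  next
    case False
    obtain M where M: "M \<in> \<C>" "\<And>C. C \<in> \<C> \<Longrightarrow> M \<subseteq> C \<Longrightarrow> M = C"
      using finite_has_maximal[OF psubset.hyps False] by blast
    have sub: "C \<subseteq> M" if "C \<in> \<C>" for C
      using psubset.prems(3)[OF that M(1)] M(2)[OF that] by blast
    show ?thesis
    proof (cases "k = card \<C>")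
      case True
      obtain s where s: "s \<in> S" "s \<notin> M" using psubset.prems(2)[OF M(1)] by blast
      then have "{C \<in> \<C>. s \<notin> C} = \<C>" using sub by blast
      then have "level \<C> s = k" using True by (simp add: level_def)
      then show ?thesis using s by blast
    next
      case k: False
      have "\<exists>s\<in>M. level (\<C> - {M}) s = k"
      proof (rule psubset.IH)
        show "\<C> - {M} \<subset> \<C>" using M by blast
        show "M \<noteq> {}" using psubset.prems(2)[OF M(1)] by blast
        show "C \<noteq> {} \<and> C \<subset> M" if "C \<in> \<C> - {M}" for C
          using that psubset.prems(2)[of C] sub[of C] by blast
        show "C \<subseteq> D \<or> D \<subseteq> C" if "C \<in> \<C> - {M}" "D \<in> \<C> - {M}" for C D
          using that psubset.prems(3)[of C D] by blast
        show "k \<le> card (\<C> - {M})"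
          using k psubset.prems(4) M(1) psubset.hyps by (simp add: card_Diff_singleton)
      qed
      then obtain s where s: "s \<in> M" "level (\<C> - {M}) s = k" by blast
      have "{C \<in> \<C> - {M}. s \<notin> C} = {C \<in> \<C>. s \<notin> C}" using s by blast
      then have "level \<C> s = k" using s(2) by (simp add: level_def)
      then show ?thesis using s(1) psubset.prems(2)[OF M(1)] by blast
    qed
  qed
qed

locale subset_chain =
  fixes S :: "'a set" and \<C> :: "'a set set"
  assumes finite_chain: "finite \<C>" and S_nonempty: "S \<noteq> {}"
    and proper: "\<And>C. C \<in> \<C> \<Longrightarrow> C \<noteq> {} \<and> C \<subset> S"
    and chain: "\<And>C D. C \<in> \<C> \<Longrightarrow> D \<in> \<C> \<Longrightarrow> C \<subseteq> D \<or> D \<subseteq> C"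
begin

definition saturated :: "'a set \<Rightarrow> bool" where
  "saturated X \<longleftrightarrow> X \<subseteq> S \<and> (\<forall>x\<in>X. \<forall>s\<in>S. level \<C> s = level \<C> x \<longrightarrow> s \<in> X)"

lemma level_le: "level \<C> s \<le> card \<C>"
  unfolding level_def using finite_chain by (auto intro: card_mono)

lemma level_surj: "k \<le> card \<C> \<Longrightarrow> \<exists>s\<in>S. level \<C> s = k"
  using level_surjective[OF finite_chain S_nonempty proper chain] by blast

lemma mirror_level: "\<exists>t\<in>S. level \<C> t + level \<C> s = card \<C>"
  using level_surj[of "card \<C> - level \<C> s"] level_le[of s] by force

lemma chain_downward:
  assumes "C \<in> \<C>" "s \<in> C" "level \<C> t \<le> level \<C> s"
  shows "t \<in> C"
proof (rule ccontr)
  assume t: "t \<notin> C"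
  have "{D \<in> \<C>. s \<notin> D} \<subset> {D \<in> \<C>. t \<notin> D}"
  proof
    show "{D \<in> \<C>. s \<notin> D} \<subseteq> {D \<in> \<C>. t \<notin> D}"
    proof
      fix D assume "D \<in> {D \<in> \<C>. s \<notin> D}"
      then show "D \<in> {D \<in> \<C>. t \<notin> D}" using chain[of C D] assms t by blast
    qed
    show "{D \<in> \<C>. s \<notin> D} \<noteq> {D \<in> \<C>. t \<notin> D}" using assms(1,2) t by blast
  qed
  then have "level \<C> s < level \<C> t"
    unfolding level_def using finite_chain by (intro psubset_card_mono) auto
  then show False using assms(3) by simp
qed

text \<open>
  Consecutive layers are separated by some member of the chain, so a proper initial union of layers
  is the member that separates its last layer from the next one.
\<close>

lemma chain_if_downward:
  assumes X: "X \<subset> S" "X \<noteq> {}"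
    and down: "\<And>s t. s \<in> X \<Longrightarrow> t \<in> S \<Longrightarrow> level \<C> t \<le> level \<C> s \<Longrightarrow> t \<in> X"
  shows "X \<in> \<C>"
proof -
  \<comment> \<open>\<open>k\<close> is the lowest layer that \<open>X\<close> misses, so \<open>X\<close> consists of the layers below \<open>k\<close>.\<close>
  define k where "k = (LEAST k. \<exists>t\<in>S - X. level \<C> t = k)"
  have "\<exists>k. \<exists>t\<in>S - X. level \<C> t = k" using X by blast
  then have "\<exists>t\<in>S - X. level \<C> t = k" unfolding k_def by (rule LeastI_ex)
  then obtain t where t: "t \<in> S - X" "level \<C> t = k" by blast
  have low: "s \<in> X" if "s \<in> S" "level \<C> s < k" for s
    using that not_less_Least[of "level \<C> s" "\<lambda>k. \<exists>t\<in>S - X. level \<C> t = k"] unfolding k_def by blast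
  have lt: "level \<C> s < k" if "s \<in> X" for s
    using down[of s t] that t by (meson DiffE not_le)
  obtain x where "x \<in> X" using X by blast
  then have "k - 1 \<le> card \<C>" "0 < k" using lt[of x] level_le[of t] t(2) by auto
  then obtain s where s: "s \<in> S" "level \<C> s = k - 1" using level_surj by blast
  have "\<not> {C \<in> \<C>. t \<notin> C} \<subseteq> {C \<in> \<C>. s \<notin> C}"
  proof
    assume "{C \<in> \<C>. t \<notin> C} \<subseteq> {C \<in> \<C>. s \<notin> C}"
    then have "level \<C> t \<le> level \<C> s"
      unfolding level_def using finite_chain by (intro card_mono) auto
    then show False using s t \<open>0 < k\<close> by simp
  qed
  then obtain C where C: "C \<in> \<C>" "s \<in> C" "t \<notin> C" by blast
  have "C = X"
  proof
    show "C \<subseteq> X"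
    proof
      fix c assume c: "c \<in> C"
      have "level \<C> c < k" using chain_downward[OF C(1) c, of t] C(3) t(2) by (meson not_le)
      then show "c \<in> X" using low c proper[OF C(1)] by blast
    qed
    show "X \<subseteq> C"
    proof
      fix x assume "x \<in> X"
      then have "level \<C> x \<le> level \<C> s" using lt[of x] s(2) by simp
      then show "x \<in> C" by (rule chain_downward[OF C(1,2)])
    qed
  qed
  then show ?thesis using C(1) by simp
qed

lemma saturated_chain: "C \<in> \<C> \<Longrightarrow> saturated C"
  unfolding saturated_def using proper[of C] chain_downward[of C] by auto

lemma saturated_Diff: "saturated X \<Longrightarrow> saturated (S - X)"
  unfolding saturated_def by (metis Diff_iff Diff_subset)

lemma saturated_empty: "saturated {}" and saturated_S: "saturated S"
  by (auto simp: saturated_def)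

lemma mirror_subset: "mirror S \<C> X \<subseteq> S"
  by (auto simp: mirror_def)

lemma saturated_mirror: "saturated (mirror S \<C> X)"
  by (auto simp: saturated_def mirror_def)

lemma mirror_mono: "X \<subseteq> Y \<Longrightarrow> mirror S \<C> X \<subseteq> mirror S \<C> Y"
  by (auto simp: mirror_def)

lemma mirror_mirror:
  assumes "saturated X"
  shows "mirror S \<C> (mirror S \<C> X) = X"
proof
  show "mirror S \<C> (mirror S \<C> X) \<subseteq> X"
  proof
    fix s assume "s \<in> mirror S \<C> (mirror S \<C> X)"
    then obtain t x where "s \<in> S" "x \<in> X" "level \<C> s + level \<C> t = card \<C>" "level \<C> t + level \<C> x = card \<C>"
      unfolding mirror_def by blast
    moreover from this have "level \<C> s = level \<C> x" by linarith
    ultimately show "s \<in> X" using assms unfolding saturated_def by blast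
  qed
  show "X \<subseteq> mirror S \<C> (mirror S \<C> X)"
  proof
    fix x assume x: "x \<in> X"
    obtain t where t: "t \<in> S" "level \<C> t + level \<C> x = card \<C>" using mirror_level[of x] by blast
    then have "t \<in> mirror S \<C> X" using x by (auto simp: mirror_def)
    moreover have "x \<in> S" using x assms by (auto simp: saturated_def)
    moreover have "level \<C> x + level \<C> t = card \<C>" using t by simp
    ultimately show "x \<in> mirror S \<C> (mirror S \<C> X)" unfolding mirror_def[of S \<C> "mirror S \<C> X"] by blast
  qed
qed

lemma mirror_subset_iff:
  assumes "saturated X" "saturated Y"
  shows "mirror S \<C> X \<subseteq> mirror S \<C> Y \<longleftrightarrow> X \<subseteq> Y"
  using mirror_mono[of X Y] mirror_mono[of "mirror S \<C> X" "mirror S \<C> Y"] mirror_mirror assms by metis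

lemma mirror_disjoint:
  assumes "saturated X" "X \<inter> Y = {}" "Y \<subseteq> S"
  shows "mirror S \<C> X \<inter> mirror S \<C> Y = {}"
proof (rule ccontr)
  assume "mirror S \<C> X \<inter> mirror S \<C> Y \<noteq> {}"
  then obtain s x y where "x \<in> X" "y \<in> Y" "level \<C> s + level \<C> x = card \<C>" "level \<C> s + level \<C> y = card \<C>"
    by (auto simp: mirror_def)
  moreover from this have "level \<C> y = level \<C> x" by linarith
  ultimately show False using assms unfolding saturated_def by blast
qed

lemma mirror_disjoint_iff:
  assumes "saturated X" "saturated Y"
  shows "mirror S \<C> X \<inter> mirror S \<C> Y = {} \<longleftrightarrow> X \<inter> Y = {}"
  using mirror_disjoint[OF assms(1)] mirror_disjoint[OF saturated_mirror, of X "mirror S \<C> Y"]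
    mirror_mirror[OF assms(1)] mirror_mirror[OF assms(2)] mirror_subset assms(2)
  unfolding saturated_def by metis

lemma mirror_empty: "mirror S \<C> {} = {}"
  by (simp add: mirror_def)

lemma mirror_S: "mirror S \<C> S = S"
  using mirror_mirror[OF saturated_S] mirror_mono[OF mirror_subset, of S] mirror_subset by blast

lemma mirror_eq_empty_iff: "saturated X \<Longrightarrow> mirror S \<C> X = {} \<longleftrightarrow> X = {}"
  using mirror_mirror mirror_empty by metis

lemma S_subset_mirror_iff: "saturated X \<Longrightarrow> S \<subseteq> mirror S \<C> X \<longleftrightarrow> S \<subseteq> X"
  using mirror_subset_iff[OF saturated_S, of X] mirror_S by simp

lemma mirror_upward:
  assumes X: "\<And>s t. s \<in> X \<Longrightarrow> t \<in> S \<Longrightarrow> level \<C> t \<le> level \<C> s \<Longrightarrow> t \<in> X"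
    and "s \<in> mirror S \<C> X" "t \<in> S" "level \<C> s \<le> level \<C> t"
  shows "t \<in> mirror S \<C> X"
proof -
  obtain x where x: "x \<in> X" "level \<C> s + level \<C> x = card \<C>" using assms(2) by (auto simp: mirror_def)
  obtain y where y: "y \<in> S" "level \<C> y + level \<C> t = card \<C>" using mirror_level by blast
  have "level \<C> y \<le> level \<C> x" using x(2) y(2) assms(4) by linarith
  then have "y \<in> X" using X x(1) y(1) by blast
  then show ?thesis using y assms(3) by (auto simp: mirror_def add.commute)
qed

lemma mirror_downward:
  assumes X: "\<And>s t. s \<in> X \<Longrightarrow> t \<in> S \<Longrightarrow> level \<C> s \<le> level \<C> t \<Longrightarrow> t \<in> X"
    and "s \<in> mirror S \<C> X" "t \<in> S" "level \<C> t \<le> level \<C> s"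
  shows "t \<in> mirror S \<C> X"
proof -
  obtain x where x: "x \<in> X" "level \<C> s + level \<C> x = card \<C>" using assms(2) by (auto simp: mirror_def)
  obtain y where y: "y \<in> S" "level \<C> y + level \<C> t = card \<C>" using mirror_level by blast
  have "level \<C> x \<le> level \<C> y" using x(2) y(2) assms(4) by linarith
  then have "y \<in> X" using X x(1) y(1) by blast
  then show ?thesis using y assms(3) by (auto simp: mirror_def add.commute)
qed

lemma mirror_Diff:
  assumes "saturated X"
  shows "mirror S \<C> (S - X) = S - mirror S \<C> X"
proof
  show "mirror S \<C> (S - X) \<subseteq> S - mirror S \<C> X"
    using mirror_disjoint[OF assms, of "S - X"] mirror_subset by blast
  show "S - mirror S \<C> X \<subseteq> mirror S \<C> (S - X)"
  proof
    fix s assume s: "s \<in> S - mirror S \<C> X"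
    obtain t where t: "t \<in> S" "level \<C> t + level \<C> s = card \<C>" using mirror_level by blast
    have "t \<notin> X"
    proof
      assume "t \<in> X"
      then show False using s t by (auto simp: mirror_def add.commute)
    qed
    then show "s \<in> mirror S \<C> (S - X)" using s t by (auto simp: mirror_def add.commute)
  qed
qed

text \<open>
  The complement of the mirror image of an initial union of layers is again one, hence a member of
  the chain; an injective map of a finite chain to itself is onto.
\<close>

lemma image_Diff_mirror: "(\<lambda>C. S - mirror S \<C> C) ` \<C> = \<C>"
proof (rule endo_inj_surj[OF finite_chain])
  show "(\<lambda>C. S - mirror S \<C> C) ` \<C> \<subseteq> \<C>"
  proof
    fix X assume "X \<in> (\<lambda>C. S - mirror S \<C> C) ` \<C>"
    then obtain C where C: "C \<in> \<C>" "X = S - mirror S \<C> C" by blast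
    have sat: "saturated C" using saturated_chain C by blast
    show "X \<in> \<C>"
    proof (rule chain_if_downward)
      have "mirror S \<C> C \<noteq> {}" using mirror_eq_empty_iff[OF sat] proper[OF C(1)] by blast
      then show "X \<subset> S" using C(2) mirror_subset by blast
      show "X \<noteq> {}" using S_subset_mirror_iff[OF sat] proper[OF C(1)] C(2) by blast
      show "t \<in> X" if "s \<in> X" "t \<in> S" "level \<C> t \<le> level \<C> s" for s t
      proof (rule ccontr)
        assume "t \<notin> X"
        then have "t \<in> mirror S \<C> C" using that C by blast
        then have "s \<in> mirror S \<C> C"
          using mirror_upward[of C t s] chain_downward[OF C(1)] that C by blast
        then show False using that C by blast
      qed
    qed
  qed
  show "inj_on (\<lambda>C. S - mirror S \<C> C) \<C>"
  proof (rule inj_onI)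
    fix C D assume *: "C \<in> \<C>" "D \<in> \<C>" "S - mirror S \<C> C = S - mirror S \<C> D"
    then have "mirror S \<C> C = mirror S \<C> D" using mirror_subset[of C] mirror_subset[of D] by blast
    then show "C = D" using mirror_mirror[OF saturated_chain] * by metis
  qed
qed

lemma inj_on_Diff: "inj_on (\<lambda>C. S - C) \<C>"
proof (rule inj_onI)
  fix C D assume "C \<in> \<C>" "D \<in> \<C>" "S - C = S - D"
  then show "C = D" using proper[of C] proper[of D] by blast
qed

lemma card_Diff_image: "card ((\<lambda>C. S - C) ` \<C>) = card \<C>"
  by (rule card_image[OF inj_on_Diff])

lemma level_Diff_image:
  assumes "s \<in> S"
  shows "level ((\<lambda>C. S - C) ` \<C>) s + level \<C> s = card \<C>"
proof -
  have "{D \<in> (\<lambda>C. S - C) ` \<C>. s \<notin> D} = (\<lambda>C. S - C) ` {C \<in> \<C>. s \<in> C}"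
    using assms by auto
  then have "level ((\<lambda>C. S - C) ` \<C>) s = card {C \<in> \<C>. s \<in> C}"
    unfolding level_def using card_image[OF inj_on_subset[OF inj_on_Diff]] by (metis (no_types, lifting) mem_Collect_eq subsetI)
  moreover have "card {C \<in> \<C>. s \<in> C} + card {C \<in> \<C>. s \<notin> C} = card \<C>"
  proof -
    have "card ({C \<in> \<C>. s \<in> C} \<union> {C \<in> \<C>. s \<notin> C}) = card {C \<in> \<C>. s \<in> C} + card {C \<in> \<C>. s \<notin> C}"
      by (rule card_Un_disjoint) (use finite_chain in auto)
    moreover have "{C \<in> \<C>. s \<in> C} \<union> {C \<in> \<C>. s \<notin> C} = \<C>" by blast
    ultimately show ?thesis by simp
  qed
  ultimately show ?thesis by (simp add: level_def)
qed

text \<open>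
  The complements form a chain with the same layers in the opposite order. Opposite layers remain
  opposite, which is why mirroring twice, once with respect to each chain, is the identity.
\<close>

lemma mirror_Diff_image:
  assumes "X \<subseteq> S"
  shows "mirror S ((\<lambda>C. S - C) ` \<C>) X = mirror S \<C> X"
proof -
  have "level ((\<lambda>C. S - C) ` \<C>) s + level ((\<lambda>C. S - C) ` \<C>) x = card \<C> \<longleftrightarrow>
      level \<C> s + level \<C> x = card \<C>" if "s \<in> S" "x \<in> X" for s x
    using level_Diff_image[of s] level_Diff_image[of x] assms that by auto
  then show ?thesis unfolding mirror_def card_Diff_image by blast
qed

end

section \<open>Tubes and an autonomous subset\<close>

text \<open>
  Tubes and tubings of a strict order, with connectivity measured in the comparability graph. For
  convex sets this agrees with connectivity in the Hasse diagram (\<open>hasse_connected_iff\<close>), and it is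
  manifestly unaffected by flips.
\<close>

definition tube :: "'a set \<Rightarrow> 'a rel \<Rightarrow> 'a set \<Rightarrow> bool" where
  "tube P R \<tau> \<longleftrightarrow> \<tau> \<subset> P \<and> card \<tau> \<ge> 2 \<and> order_convex P R \<tau> \<and>
     connected_induced_subgraph (comparability_graph R) \<tau>"

definition tubing :: "'a set \<Rightarrow> 'a rel \<Rightarrow> 'a set set \<Rightarrow> bool" where
  "tubing P R T \<longleftrightarrow>
     (\<forall>\<tau>\<in>T. tube P R \<tau>) \<and>
     (\<forall>\<sigma>\<in>T. \<forall>\<tau>\<in>T. \<sigma> \<subseteq> \<tau> \<or> \<tau> \<subseteq> \<sigma> \<or> \<sigma> \<inter> \<tau> = {}) \<and>
     acyclic (tubing_digraph R T)"

definition below :: "'a rel \<Rightarrow> 'a set \<Rightarrow> 'a set" where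
  "below R S = {x. x \<notin> S \<and> (\<exists>s\<in>S. (x, s) \<in> R)}"

abbreviation above :: "'a rel \<Rightarrow> 'a set \<Rightarrow> 'a set" where
  "above R S \<equiv> below (R\<inverse>) S"

definition crosses :: "'a set \<Rightarrow> 'a set \<Rightarrow> bool" where
  "crosses S \<tau> \<longleftrightarrow> \<tau> \<inter> S \<noteq> {} \<and> \<not> \<tau> \<subseteq> S \<and> \<not> S \<subseteq> \<tau>"

lemma tube_converse [simp]: "tube P (R\<inverse>) \<tau> \<longleftrightarrow> tube P R \<tau>"
  by (auto simp: tube_def order_convex_def)

lemma tubing_digraph_converse: "tubing_digraph (R\<inverse>) T = (tubing_digraph R T)\<inverse>"
  by (auto simp: tubing_digraph_def)

lemma tubing_converse [simp]: "tubing P (R\<inverse>) T \<longleftrightarrow> tubing P R T"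
  by (simp add: tubing_def tubing_digraph_converse)

lemma flip_converse: "flip S (R\<inverse>) = (flip S R)\<inverse>"
  by (auto simp: flip_def)

lemma below_flip [simp]: "below (flip S R) S = below R S"
  by (auto simp: below_def flip_def)

lemma above_flip [simp]: "above (flip S R) S = above R S"
  by (simp flip: flip_converse)

lemma tube_convex:
  assumes "tube P R \<tau>" "x \<in> \<tau>" "z \<in> \<tau>" "y \<in> P" "(x, y) \<in> R" "(y, z) \<in> R"
  shows "y \<in> \<tau>"
  using assms unfolding tube_def order_convex_def by blast

lemma connectedI:
  assumes "sym E" "l \<in> \<sigma>" "\<And>x. x \<in> \<sigma> \<Longrightarrow> (l, x) \<in> (E \<inter> \<sigma> \<times> \<sigma>)\<^sup>*"
  shows "connected_induced_subgraph E \<sigma>"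
proof -
  have "sym (E \<inter> \<sigma> \<times> \<sigma>)" using assms(1) by (auto simp: sym_def)
  then have "(x, l) \<in> (E \<inter> \<sigma> \<times> \<sigma>)\<^sup>*" if "x \<in> \<sigma>" for x
    using assms(3)[OF that] by (meson sym_rtrancl symD)
  then show ?thesis
    unfolding connected_induced_subgraph_def using assms(3) rtrancl_trans by fast
qed

lemma sym_comparability_graph: "sym (comparability_graph R)"
  by (auto simp: comparability_graph_def sym_def)

lemma acyclic_vimage:
  assumes "acyclic D" "\<And>a b. (a, b) \<in> E \<Longrightarrow> (\<psi> a, \<psi> b) \<in> D"
  shows "acyclic E"
proof -
  have "(\<psi> a, \<psi> b) \<in> D\<^sup>+" if "(a, b) \<in> E\<^sup>+" for a b
    using that
  proof (induction rule: trancl_induct)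
    case (base b)
    then show ?case using assms(2) by blast
  next
    case (step b c)
    show ?case using trancl_into_trancl[OF step(3) assms(2)[OF step(2)]] .
  qed
  then show ?thesis using assms(1) unfolding acyclic_def by blast
qed

locale autonomous_subset =
  fixes P :: "'a set" and R :: "'a rel" and S :: "'a set"
  assumes finite_P: "finite P" and order: "strict_order_on P R"
    and S_subset: "S \<subseteq> P" and autonomous: "autonomous R S"
begin

lemma trans: "(x, y) \<in> R \<Longrightarrow> (y, z) \<in> R \<Longrightarrow> (x, z) \<in> R"
  using order unfolding strict_order_on_def by (meson transD)

lemma irrefl: "(x, x) \<notin> R"
  using order unfolding strict_order_on_def irrefl_def by blast



lemma dual: "autonomous_subset P (R\<inverse>) S"
proof
  show "autonomous (R\<inverse>) S"
    by (rule autonomousI; simp; metis autonomousD[OF autonomous])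
  show "strict_order_on P (R\<inverse>)" by (rule strict_order_converse[OF order])
qed (rule finite_P, rule S_subset)

lemma flipped: "autonomous_subset P (flip S R) S"
proof
  show "autonomous (flip S R) S" by (rule autonomous_flip[OF autonomous])
  show "strict_order_on P (flip S R)" by (rule strict_order_flip[OF order autonomous])
qed (rule finite_P, rule S_subset)

lemma below_iff: "s \<in> S \<Longrightarrow> x \<notin> S \<Longrightarrow> (x, s) \<in> R \<longleftrightarrow> x \<in> below R S"
  unfolding below_def using autonomousD(1)[OF autonomous, of x _ s] by auto

lemma above_iff: "s \<in> S \<Longrightarrow> x \<notin> S \<Longrightarrow> (s, x) \<in> R \<longleftrightarrow> x \<in> above R S"
  using autonomous_subset.below_iff[OF dual, of s x] by simp

lemma below_above: "x \<in> below R S \<Longrightarrow> y \<in> above R S \<Longrightarrow> (x, y) \<in> R"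
  using trans[of x _ y] above_iff[of _ y] unfolding below_def by blast

lemma below_notin: "x \<in> below R S \<Longrightarrow> x \<notin> S" and above_notin: "x \<in> above R S \<Longrightarrow> x \<notin> S"
  by (auto simp: below_def)

lemma tube_between:
  assumes "tube P R \<tau>" "\<tau> \<inter> below R S \<noteq> {}" "\<tau> \<inter> above R S \<noteq> {}"
  shows "S \<subseteq> \<tau>"
proof
  fix s assume s: "s \<in> S"
  obtain x y where "x \<in> \<tau>" "x \<in> below R S" "y \<in> \<tau>" "y \<in> above R S" using assms by blast
  moreover from this have "(x, s) \<in> R" "(s, y) \<in> R"
    using below_iff[OF s, of x] above_iff[OF s, of y] below_notin[of x] above_notin[of y] by blast+
  ultimately show "s \<in> \<tau>" using tube_convex[OF assms(1), of x y s] s S_subset by blast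
qed

text \<open>
  A path in the tube that leaves \<open>S\<close> does so through an element comparable to \<open>S\<close>. Elements on both
  sides would force \<open>S\<close> into the tube by convexity.
\<close>

lemma crossing_tube:
  assumes \<tau>: "tube P R \<tau>" and "crosses S \<tau>"
  shows "\<tau> \<inter> below R S \<noteq> {} \<and> \<tau> \<inter> above R S = {} \<or> \<tau> \<inter> above R S \<noteq> {} \<and> \<tau> \<inter> below R S = {}"
proof -
  let ?E = "comparability_graph R \<inter> \<tau> \<times> \<tau>"
  obtain s x where sx: "s \<in> \<tau>" "s \<in> S" "x \<in> \<tau>" "x \<notin> S" using assms unfolding crosses_def by blast
  then have "(s, x) \<in> ?E\<^sup>*" using \<tau> unfolding tube_def connected_induced_subgraph_def by blast
  then have "x \<in> S \<or> \<tau> \<inter> (below R S \<union> above R S) \<noteq> {}"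
  proof (induction rule: rtrancl_induct)
    case (step y z)
    then show ?case
      using below_iff[of y z] above_iff[of y z] unfolding comparability_graph_def by blast
  qed (use sx in simp)
  then show ?thesis using tube_between[OF \<tau>] sx assms(2) unfolding crosses_def by blast
qed

lemma crossing_down:
  assumes "tube P R \<tau>" "\<tau> \<inter> below R S \<noteq> {}" "s \<in> \<tau>" "s \<in> S" "t \<in> S" "(t, s) \<in> R"
  shows "t \<in> \<tau>"
proof -
  obtain x where x: "x \<in> \<tau>" "x \<in> below R S" using assms(2) by blast
  then have "(x, t) \<in> R" using below_iff[OF \<open>t \<in> S\<close>, of x] below_notin by blast
  then show ?thesis using tube_convex[OF assms(1) x(1) assms(3), of t] assms S_subset by blast
qed

text \<open>
  A chain of three elements of \<open>S\<close> is reversed as a whole, and convexity is symmetric under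
  reversal. Otherwise a middle element outside the tube is compared with its neighbours as before,
  since a tube that does not cross \<open>S\<close> and omits an element of \<open>S\<close> lies inside \<open>S\<close> or avoids it.
\<close>

lemma tube_flip_noncrossing:
  assumes \<tau>: "tube P R \<tau>" and nc: "\<not> crosses S \<tau>"
  shows "tube P (flip S R) \<tau>"
proof -
  have "order_convex P (flip S R) \<tau>"
    unfolding order_convex_def
  proof (intro ballI impI)
    fix x z y
    assume *: "x \<in> \<tau>" "z \<in> \<tau>" "y \<in> P" "(x, y) \<in> flip S R \<and> (y, z) \<in> flip S R"
    show "y \<in> \<tau>"
    proof (cases "x \<in> S \<and> y \<in> S \<and> z \<in> S")
      case True
      then have "(z, y) \<in> R" "(y, x) \<in> R" using * by (auto simp: flip_def)
      then show ?thesis using tube_convex[OF \<tau>, of z x y] * by blast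
    next
      case F: False
      show ?thesis
      proof (rule ccontr)
        assume "y \<notin> \<tau>"
        then have "y \<in> S \<Longrightarrow> x \<notin> S \<and> z \<notin> S" using F nc * unfolding crosses_def by blast
        then have "(x, y) \<in> R" "(y, z) \<in> R" using * by (auto simp: flip_def split: if_splits)
        then show False using tube_convex[OF \<tau>, of x z y] * \<open>y \<notin> \<tau>\<close> by blast
      qed
    qed
  qed
  then show ?thesis using \<tau> by (simp add: tube_def)
qed

text \<open>
  Any nonempty proper down-set of the flipped order can serve as the new trace on \<open>S\<close>: an outside
  element cannot tell the elements of \<open>S\<close> apart, so a path through the old trace can be rerouted
  through any element \<open>j\<close> of the new one. The dual statement for tubes that reach above \<open>S\<close> follows
  by applying this to the reversed order.
\<close>

lemma tube_flip_crossing: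
  assumes \<tau>: "tube P R \<tau>" and cr: "crosses S \<tau>" and low: "\<tau> \<inter> below R S \<noteq> {}"
    and J: "J \<noteq> {}" "J \<subset> S"
    and down: "\<And>s t. s \<in> J \<Longrightarrow> t \<in> S \<Longrightarrow> (t, s) \<in> flip S R \<Longrightarrow> t \<in> J"
  shows "tube P (flip S R) ((\<tau> - S) \<union> J)"
proof -
  let ?\<sigma> = "(\<tau> - S) \<union> J"
  have up: "\<tau> \<inter> above R S = {}" using crossing_tube[OF \<tau> cr] low by blast
  obtain j where j: "j \<in> J" "j \<in> S" using J by blast
  obtain l where l: "l \<in> \<tau>" "l \<in> below R S" "l \<notin> S" using low below_notin by blast
  obtain s0 where s0: "s0 \<in> \<tau>" "s0 \<in> S" using cr unfolding crosses_def by blast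
  have \<tau>P: "\<tau> \<subseteq> P" using \<tau> unfolding tube_def by blast
  have conv: "order_convex P (flip S R) ?\<sigma>"
    unfolding order_convex_def
  proof (intro ballI impI)
    fix x z y
    assume *: "x \<in> ?\<sigma>" "z \<in> ?\<sigma>" "y \<in> P" "(x, y) \<in> flip S R \<and> (y, z) \<in> flip S R"
    have JS: "z \<in> S \<longleftrightarrow> z \<in> J" "x \<in> S \<longleftrightarrow> x \<in> J" using *(1,2) J by blast+
    show "y \<in> ?\<sigma>"
    proof (cases "y \<in> S")
      case True
      show ?thesis
      proof (cases "z \<in> S")
        case z: True
        then show ?thesis using down[of z y] JS(1) * True by blast
      next
        case False
        then have "(y, z) \<in> R" using * by (auto simp: flip_def)
        then have "z \<in> above R S" using above_iff[OF True False] by blast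
        then show ?thesis using up *(2) False J by blast
      qed
    next
      case y: False
      then have R: "(x, y) \<in> R" "(y, z) \<in> R" using * by (auto simp: flip_def)
      have "x \<notin> S"
      proof
        assume x: "x \<in> S"
        show False
        proof (cases "z \<in> S")
          case True
          then have "y \<in> below R S" "y \<in> above R S"
            using above_iff[OF x y] below_iff[OF True y] R by blast+
          then show False using below_above irrefl by blast
        next
          case False
          then have "z \<in> above R S" using above_iff[OF x False] trans[OF R] by blast
          then show False using up *(2) False J by blast
        qed
      qed
      then have x: "x \<in> \<tau>" using * J by blast
      have "y \<in> \<tau>"
      proof (cases "z \<in> S")
        case True
        then have "(y, s0) \<in> R" using R(2) below_iff[OF True y] below_iff[OF s0(2) y] by blast
        then show ?thesis using tube_convex[OF \<tau> x s0(1) *(3) R(1)] by blast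
      next
        case False
        then have "z \<in> \<tau>" using * J by blast
        then show ?thesis using tube_convex[OF \<tau> x _ *(3) R] by blast
      qed
      then show ?thesis using y by blast
    qed
  qed
  let ?E = "comparability_graph R"
  \<comment> \<open>Collapsing \<open>S\<close> to the single element \<open>j\<close> of the new trace sends paths to paths.\<close>
  define f where "f x = (if x \<in> S then j else x)" for x
  have adj: "(j, y) \<in> ?E \<and> (y, j) \<in> ?E" if "(x, y) \<in> ?E \<or> (y, x) \<in> ?E" "x \<in> S" "y \<notin> S" for x y
    using that below_iff[of x y] above_iff[of x y] below_iff[OF j(2), of y] above_iff[OF j(2), of y] j(2)
    unfolding comparability_graph_def by blast
  have path: "(f l, f x) \<in> (?E \<inter> ?\<sigma> \<times> ?\<sigma>)\<^sup>*" if "(l, x) \<in> (?E \<inter> \<tau> \<times> \<tau>)\<^sup>*" for x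
    using that
  proof (induction rule: rtrancl_induct)
    case (step x y)
    have in\<sigma>: "f x \<in> ?\<sigma>" "f y \<in> ?\<sigma>" using step(2) j by (auto simp: f_def)
    have "f x = f y \<or> (f x, f y) \<in> ?E"
      using step(2) adj[of x y] adj[of y x] by (auto simp: f_def)
    then have "(f x, f y) \<in> (?E \<inter> ?\<sigma> \<times> ?\<sigma>)\<^sup>*" using in\<sigma> by auto
    then show ?case using step(3) by (meson rtrancl_trans)
  qed simp
  have conn: "connected_induced_subgraph (comparability_graph (flip S R)) ?\<sigma>"
    unfolding comparability_graph_flip
  proof (rule connectedI[OF sym_comparability_graph, of l])
    show "l \<in> ?\<sigma>" using l by blast
    fix x assume x: "x \<in> ?\<sigma>"
    show "(l, x) \<in> (?E \<inter> ?\<sigma> \<times> ?\<sigma>)\<^sup>*"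
    proof (cases "x \<in> S")
      case True
      then have "(l, x) \<in> R" using below_iff[OF True l(3)] l by blast
      then have "(l, x) \<in> ?E" using True l by (auto simp: comparability_graph_def)
      then show ?thesis using x l by auto
    next
      case False
      then have "(l, x) \<in> (?E \<inter> \<tau> \<times> \<tau>)\<^sup>*"
        using \<tau> x l J unfolding tube_def connected_induced_subgraph_def by blast
      from path[OF this] show ?thesis using False l by (simp add: f_def)
    qed
  qed
  have "?\<sigma> \<subset> P" using \<tau>P J S_subset by blast
  moreover have "2 \<le> card ?\<sigma>"
  proof -
    have "finite ?\<sigma>" using \<open>?\<sigma> \<subset> P\<close> finite_P by (meson finite_subset psubset_imp_subset)
    moreover have "{l, j} \<subseteq> ?\<sigma>" "l \<noteq> j" using l j by auto
    ultimately show ?thesis by (metis card_2_iff card_mono)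
  qed
  ultimately show ?thesis using conv conn by (simp add: tube_def)
qed

text \<open>
  A cycle through tubes inside \<open>S\<close> and others can be shortcut. A tube with an edge into a tube
  inside \<open>S\<close> contains an element below \<open>S\<close> (\<open>into\<close>), a tube with an edge from one contains an element
  above \<open>S\<close> (\<open>out\<close>), and neither contains \<open>S\<close>. Two such tubes are not nested, as the larger one would
  contain \<open>S\<close>; so they are disjoint, and there is a direct edge between them.
\<close>

lemma acyclic_tubing_digraph_split:
  assumes tube: "\<And>\<tau>. \<tau> \<in> T \<Longrightarrow> tube P R \<tau>"
    and nested: "\<And>\<sigma> \<tau>. \<sigma> \<in> T \<Longrightarrow> \<tau> \<in> T \<Longrightarrow> \<sigma> \<subseteq> \<tau> \<or> \<tau> \<subseteq> \<sigma> \<or> \<sigma> \<inter> \<tau> = {}"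
    and inside: "acyclic (tubing_digraph R (T \<inter> Pow S))"
    and outside: "acyclic (tubing_digraph R (T - Pow S))"
  shows "acyclic (tubing_digraph R T)"
proof -
  let ?D = "tubing_digraph R T" and ?A = "tubing_digraph R (T \<inter> Pow S)"
    and ?B = "tubing_digraph R (T - Pow S)"
  have into: "\<sigma> \<inter> below R S \<noteq> {} \<and> \<not> S \<subseteq> \<sigma>"
    if e: "(\<sigma>, \<rho>) \<in> ?D" "\<not> \<sigma> \<subseteq> S" "\<rho> \<subseteq> S" for \<sigma> \<rho>
  proof -
    obtain x y where xy: "x \<in> \<sigma>" "y \<in> \<rho>" "(x, y) \<in> R" and T: "\<sigma> \<in> T" "\<sigma> \<inter> \<rho> = {}"
      using e(1) unfolding tubing_digraph_def by blast
    have y: "y \<in> S" "y \<notin> \<sigma>" using xy T e by blast+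
    have "\<sigma> \<inter> below R S \<noteq> {}"
    proof (cases "x \<in> S")
      case False
      then show ?thesis using below_iff[OF y(1) False] xy by blast
    next
      case True
      then have "crosses S \<sigma>" using xy y e(2) unfolding crosses_def by blast
      moreover have "\<sigma> \<inter> above R S = {}"
      proof (rule ccontr)
        assume "\<sigma> \<inter> above R S \<noteq> {}"
        then have "y \<in> \<sigma>"
          using autonomous_subset.crossing_down[OF dual, of \<sigma> x y] tube[OF T(1)] xy y True by simp
        then show False using y by blast
      qed
      ultimately show ?thesis using crossing_tube[OF tube[OF T(1)]] by blast
    qed
    then show ?thesis using y by blast
  qed
  have out: "\<sigma> \<inter> above R S \<noteq> {} \<and> \<not> S \<subseteq> \<sigma>"
    if e: "(\<rho>, \<sigma>) \<in> ?D" "\<not> \<sigma> \<subseteq> S" "\<rho> \<subseteq> S" for \<sigma> \<rho>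
  proof -
    obtain x y where xy: "x \<in> \<rho>" "y \<in> \<sigma>" "(x, y) \<in> R" and T: "\<sigma> \<in> T" "\<rho> \<inter> \<sigma> = {}"
      using e(1) unfolding tubing_digraph_def by blast
    have x: "x \<in> S" "x \<notin> \<sigma>" using xy T e by blast+
    have "\<sigma> \<inter> above R S \<noteq> {}"
    proof (cases "y \<in> S")
      case False
      then show ?thesis using above_iff[OF x(1) False] xy by blast
    next
      case True
      then have "crosses S \<sigma>" using xy x e(2) unfolding crosses_def by blast
      moreover have "\<sigma> \<inter> below R S = {}"
        using crossing_down[of \<sigma> y x] tube[OF T(1)] xy x True by blast
      ultimately show ?thesis using crossing_tube[OF tube[OF T(1)]] by blast
    qed
    then show ?thesis using x by blast
  qed
  have D_T: "\<sigma> \<in> T \<and> \<tau> \<in> T" if "(\<sigma>, \<tau>) \<in> ?D" for \<sigma> \<tau>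
    using that unfolding tubing_digraph_def by blast
  have BD: "(\<sigma>, \<tau>) \<in> ?B" if "(\<sigma>, \<tau>) \<in> ?D" "\<not> \<sigma> \<subseteq> S" "\<not> \<tau> \<subseteq> S" for \<sigma> \<tau>
    using that unfolding tubing_digraph_def by blast
  have AD: "(\<sigma>, \<tau>) \<in> ?A" if "(\<sigma>, \<tau>) \<in> ?D" "\<sigma> \<subseteq> S" "\<tau> \<subseteq> S" for \<sigma> \<tau>
    using that unfolding tubing_digraph_def by blast
  \<comment> \<open>While a path runs inside \<open>S\<close>, remember the last tube \<open>\<upsilon>\<close> before it entered \<open>S\<close>.\<close>
  have shortcut: "(\<not> \<tau> \<subseteq> S \<longrightarrow> (\<sigma>, \<tau>) \<in> ?B\<^sup>+) \<and>
      (\<tau> \<subseteq> S \<longrightarrow> (\<exists>\<upsilon>. (\<sigma>, \<upsilon>) \<in> ?B\<^sup>* \<and> \<upsilon> \<in> T \<and> \<not> \<upsilon> \<subseteq> S \<and> \<upsilon> \<inter> below R S \<noteq> {} \<and> \<not> S \<subseteq> \<upsilon>))"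
    if "(\<sigma>, \<tau>) \<in> ?D\<^sup>+" and \<sigma>: "\<not> \<sigma> \<subseteq> S" for \<sigma> \<tau>
    using that(1)
  proof (induction rule: trancl_induct)
    case (base \<tau>)
    then show ?case using BD[OF base \<sigma>] into[OF base \<sigma>] D_T[OF base] \<sigma> by blast
  next
    case (step \<tau> \<tau>')
    show ?case
    proof (cases "\<tau> \<subseteq> S")
      case False
      then have "(\<sigma>, \<tau>) \<in> ?B\<^sup>+" using step.IH by blast
      then show ?thesis
        using trancl_into_trancl[OF _ BD[OF step(2) False], of \<sigma>] trancl_into_rtrancl[of \<sigma> \<tau> ?B]
          into[OF step(2) False] D_T[OF step(2)] False by blast
    next
      case True
      then obtain \<upsilon> where \<upsilon>: "(\<sigma>, \<upsilon>) \<in> ?B\<^sup>*" "\<upsilon> \<in> T" "\<not> \<upsilon> \<subseteq> S" "\<upsilon> \<inter> below R S \<noteq> {}" "\<not> S \<subseteq> \<upsilon>"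
        using step.IH by blast
      show ?thesis
      proof (cases "\<tau>' \<subseteq> S")
        case True
        then show ?thesis using \<upsilon> by blast
      next
        case False
        have \<tau>': "\<tau>' \<in> T" "\<tau>' \<inter> above R S \<noteq> {}" "\<not> S \<subseteq> \<tau>'"
          using out[OF step(2) False True] D_T[OF step(2)] by blast+
        have "\<not> \<upsilon> \<subseteq> \<tau>'" using tube_between[OF tube[OF \<tau>'(1)]] \<tau>' \<upsilon> by blast
        moreover have "\<not> \<tau>' \<subseteq> \<upsilon>" using tube_between[OF tube[OF \<upsilon>(2)]] \<tau>' \<upsilon> by blast
        ultimately have "\<upsilon> \<inter> \<tau>' = {}" using nested[OF \<upsilon>(2) \<tau>'(1)] by blast
        moreover have "\<exists>x\<in>\<upsilon>. \<exists>y\<in>\<tau>'. (x, y) \<in> R - Id"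
        proof -
          obtain x y where "x \<in> \<upsilon>" "x \<in> below R S" "y \<in> \<tau>'" "y \<in> above R S" using \<upsilon> \<tau>' by blast
          then show ?thesis using below_above[of x y] irrefl[of x] by blast
        qed
        ultimately have "(\<upsilon>, \<tau>') \<in> ?B" using \<upsilon> \<tau>' False unfolding tubing_digraph_def by blast
        then show ?thesis using rtrancl_into_trancl1[OF \<upsilon>(1)] False by blast
      qed
    qed
  qed
  have leave: "(\<rho>, \<tau>) \<in> ?A\<^sup>+ \<or> (\<exists>\<sigma>. \<not> \<sigma> \<subseteq> S \<and> (\<rho>, \<sigma>) \<in> ?D\<^sup>+ \<and> (\<sigma>, \<tau>) \<in> ?D\<^sup>*)"
    if "(\<rho>, \<tau>) \<in> ?D\<^sup>+" "\<rho> \<subseteq> S" for \<rho> \<tau>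
    using that(1)
  proof (induction rule: trancl_induct)
    case (base \<tau>)
    then show ?case using AD[OF base that(2)] by blast
  next
    case (step \<tau> \<tau>')
    show ?case
    proof (cases "\<tau>' \<subseteq> S")
      case False
      then show ?thesis using trancl_into_trancl[OF step(1,2)] by blast
    next
      case \<tau>': True
      from step.IH show ?thesis
      proof
        assume "(\<rho>, \<tau>) \<in> ?A\<^sup>+"
        then have "\<tau> \<subseteq> S" by (rule tranclE) (auto simp: tubing_digraph_def)
        then show ?thesis
          using trancl_into_trancl[OF \<open>(\<rho>, \<tau>) \<in> ?A\<^sup>+\<close> AD[OF step(2) _ \<tau>']] by blast
      next
        assume "\<exists>\<sigma>. \<not> \<sigma> \<subseteq> S \<and> (\<rho>, \<sigma>) \<in> ?D\<^sup>+ \<and> (\<sigma>, \<tau>) \<in> ?D\<^sup>*"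
        then show ?thesis using rtrancl_into_rtrancl[OF _ step(2)] by blast
      qed
    qed
  qed
  have no_outside: "(\<sigma>, \<sigma>) \<notin> ?D\<^sup>+" if "\<not> \<sigma> \<subseteq> S" for \<sigma>
  proof
    assume "(\<sigma>, \<sigma>) \<in> ?D\<^sup>+"
    then have "(\<sigma>, \<sigma>) \<in> ?B\<^sup>+" using shortcut[OF _ that] that by simp
    then show False using outside unfolding acyclic_def by simp
  qed
  show ?thesis
    unfolding acyclic_def
  proof (intro allI notI)
    fix \<rho> assume cycle: "(\<rho>, \<rho>) \<in> ?D\<^sup>+"
    show False
    proof (cases "\<rho> \<subseteq> S")
      case False
      then show False using no_outside cycle by blast
    next
      case True
      have "(\<rho>, \<rho>) \<notin> ?A\<^sup>+" using inside unfolding acyclic_def by blast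
      then obtain \<sigma> where \<sigma>: "\<not> \<sigma> \<subseteq> S" "(\<rho>, \<sigma>) \<in> ?D\<^sup>+" "(\<sigma>, \<rho>) \<in> ?D\<^sup>*"
        using leave[OF cycle True] by blast
      then show False using no_outside[OF \<sigma>(1)] rtrancl_trancl_trancl[OF \<sigma>(3,2)] by blast
    qed
  qed
qed

end

section \<open>Reflecting a tubing in an autonomous subset\<close>

text \<open>
  The down-sets of \<open>S\<close> that a tubing determines: the traces of the crossing tubes that reach below
  \<open>S\<close>, and the complements of the traces of those that reach above. Taking complements makes both
  kinds into a single chain.
\<close>

definition traces :: "'a rel \<Rightarrow> 'a set \<Rightarrow> 'a set set \<Rightarrow> 'a set set" where
  "traces R S T = (\<lambda>\<tau>. \<tau> \<inter> S) ` {\<tau> \<in> T. crosses S \<tau> \<and> \<tau> \<inter> below R S \<noteq> {}} \<union>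
     (\<lambda>\<tau>. S - \<tau>) ` {\<tau> \<in> T. crosses S \<tau> \<and> \<tau> \<inter> above R S \<noteq> {}}"

text \<open>
  Tubes inside \<open>S\<close> stay as they are. Tubes that contain or avoid \<open>S\<close> are fixed as well, because the
  whole of \<open>S\<close> and the empty set are their own mirror images.
\<close>

definition reflect :: "'a set \<Rightarrow> 'a set set \<Rightarrow> 'a set \<Rightarrow> 'a set" where
  "reflect S \<C> \<tau> = (if \<tau> \<subseteq> S then \<tau> else (\<tau> - S) \<union> mirror S \<C> (\<tau> \<inter> S))"

locale tubing_at = autonomous_subset +
  fixes T :: "'a set set"
  assumes tubing: "tubing P R T" and S_nonempty: "S \<noteq> {}"
begin

abbreviation "\<C> \<equiv> traces R S T"
abbreviation "\<Phi> \<equiv> reflect S \<C>"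

lemma tube: "\<tau> \<in> T \<Longrightarrow> tube P R \<tau>"
  using tubing by (simp add: tubing_def)

lemma nested: "\<sigma> \<in> T \<Longrightarrow> \<tau> \<in> T \<Longrightarrow> \<sigma> \<subseteq> \<tau> \<or> \<tau> \<subseteq> \<sigma> \<or> \<sigma> \<inter> \<tau> = {}"
  using tubing by (simp add: tubing_def)

lemma acyclic: "acyclic (tubing_digraph R T)"
  using tubing by (simp add: tubing_def)

lemma dual_tubing: "tubing_at P (R\<inverse>) S T"
  using dual tubing S_nonempty unfolding tubing_at_def tubing_at_axioms_def by simp

lemma edgeI:
  assumes "\<sigma> \<in> T" "\<tau> \<in> T" "\<sigma> \<inter> \<tau> = {}" "x \<in> \<sigma>" "y \<in> \<tau>" "(x, y) \<in> R"
  shows "(\<sigma>, \<tau>) \<in> tubing_digraph R T"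
  using assms irrefl[of x] unfolding tubing_digraph_def by blast

lemma no_two_cycle:
  assumes "(\<sigma>, \<tau>) \<in> tubing_digraph R T" "(\<tau>, \<sigma>) \<in> tubing_digraph R T"
  shows False
proof -
  have "(\<sigma>, \<sigma>) \<in> (tubing_digraph R T)\<^sup>+" using assms by (meson r_into_trancl trancl_into_trancl)
  then show False using acyclic unfolding acyclic_def by blast
qed

lemma low_edge:
  assumes "\<sigma> \<in> T" "\<tau> \<in> T" "\<sigma> \<inter> \<tau> = {}" "\<sigma> \<inter> below R S \<noteq> {}" "\<tau> \<inter> S \<noteq> {}"
  shows "(\<sigma>, \<tau>) \<in> tubing_digraph R T"
proof -
  obtain x y where xy: "x \<in> \<sigma>" "x \<in> below R S" "y \<in> \<tau>" "y \<in> S" using assms(4,5) by blast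
  then have "(x, y) \<in> R" using below_iff[of y x] below_notin[of x] by blast
  then show ?thesis using edgeI[OF assms(1-3)] xy by blast
qed

text \<open>
  If they were disjoint, each would contain an element that is below all of \<open>S\<close>, hence below some
  element of the other, and the two tubes would form a cycle.
\<close>

lemma low_nested:
  assumes "\<sigma> \<in> T" "\<tau> \<in> T" "\<sigma> \<inter> S \<noteq> {}" "\<tau> \<inter> S \<noteq> {}" "\<sigma> \<inter> below R S \<noteq> {}" "\<tau> \<inter> below R S \<noteq> {}"
  shows "\<sigma> \<subseteq> \<tau> \<or> \<tau> \<subseteq> \<sigma>"
proof (rule ccontr)
  assume "\<not> ?thesis"
  then have "\<sigma> \<inter> \<tau> = {}" using nested[OF assms(1,2)] by blast
  then show False using low_edge[of \<sigma> \<tau>] low_edge[of \<tau> \<sigma>] no_two_cycle assms by blast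
qed

lemma up_nested:
  assumes "\<sigma> \<in> T" "\<tau> \<in> T" "\<sigma> \<inter> S \<noteq> {}" "\<tau> \<inter> S \<noteq> {}" "\<sigma> \<inter> above R S \<noteq> {}" "\<tau> \<inter> above R S \<noteq> {}"
  shows "\<sigma> \<subseteq> \<tau> \<or> \<tau> \<subseteq> \<sigma>"
  by (rule tubing_at.low_nested[OF dual_tubing assms])

lemma low_up_disjoint:
  assumes "\<sigma> \<in> T" "\<tau> \<in> T" "crosses S \<sigma>" "crosses S \<tau>"
    "\<sigma> \<inter> below R S \<noteq> {}" "\<tau> \<inter> above R S \<noteq> {}"
  shows "\<sigma> \<inter> \<tau> = {}"
proof -
  have "\<sigma> \<inter> above R S = {}" "\<tau> \<inter> below R S = {}"
    using crossing_tube[OF tube] assms by blast+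
  then show ?thesis using nested[OF assms(1,2)] assms(5,6) by blast
qed

lemma trace_cases:
  assumes "C \<in> \<C>"
  obtains (low) \<tau> where "\<tau> \<in> T" "crosses S \<tau>" "\<tau> \<inter> below R S \<noteq> {}" "C = \<tau> \<inter> S"
  | (up) \<tau> where "\<tau> \<in> T" "crosses S \<tau>" "\<tau> \<inter> above R S \<noteq> {}" "C = S - \<tau>"
  using assms unfolding traces_def by blast

lemma low_trace: "\<tau> \<in> T \<Longrightarrow> crosses S \<tau> \<Longrightarrow> \<tau> \<inter> below R S \<noteq> {} \<Longrightarrow> \<tau> \<inter> S \<in> \<C>"
  and up_trace: "\<tau> \<in> T \<Longrightarrow> crosses S \<tau> \<Longrightarrow> \<tau> \<inter> above R S \<noteq> {} \<Longrightarrow> S - \<tau> \<in> \<C>"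
  unfolding traces_def by blast+

lemma finite_T: "finite T"
proof (rule finite_subset)
  show "T \<subseteq> Pow P" using tube unfolding tube_def by blast
qed (simp add: finite_P)

sublocale subset_chain S \<C>
proof
  show "finite \<C>" unfolding traces_def using finite_T by simp
  show "S \<noteq> {}" by (rule S_nonempty)
  show "C \<noteq> {} \<and> C \<subset> S" if "C \<in> \<C>" for C
    using that unfolding traces_def crosses_def by blast
  show "C \<subseteq> D \<or> D \<subseteq> C" if C: "C \<in> \<C>" and D: "D \<in> \<C>" for C D
    using C
  proof (cases rule: trace_cases)
    case (low \<sigma>)
    from D show ?thesis
    proof (cases rule: trace_cases)
      case low': (low \<tau>)
      have "\<sigma> \<subseteq> \<tau> \<or> \<tau> \<subseteq> \<sigma>" by (rule low_nested) (use low low' in \<open>auto simp: crosses_def\<close>)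
      then show ?thesis using low(4) low'(4) by blast
    next
      case (up \<tau>)
      have "\<sigma> \<inter> \<tau> = {}" by (rule low_up_disjoint) (use low up in auto)
      then show ?thesis using low(4) up(4) by blast
    qed
  next
    case (up \<sigma>)
    from D show ?thesis
    proof (cases rule: trace_cases)
      case (low \<tau>)
      have "\<tau> \<inter> \<sigma> = {}" by (rule low_up_disjoint) (use low up in auto)
      then show ?thesis using low(4) up(4) by blast
    next
      case up': (up \<tau>)
      have "\<sigma> \<subseteq> \<tau> \<or> \<tau> \<subseteq> \<sigma>" by (rule up_nested) (use up up' in \<open>auto simp: crosses_def\<close>)
      then show ?thesis using up(4) up'(4) by blast
    qed
  qed
qed

lemma trace_down:
  assumes "C \<in> \<C>" "s \<in> C" "t \<in> S" "(t, s) \<in> R"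
  shows "t \<in> C"
  using assms(1)
proof (cases rule: trace_cases)
  case (low \<tau>)
  then show ?thesis using crossing_down[OF tube[OF low(1)] low(3)] assms by blast
next
  case (up \<tau>)
  then show ?thesis
    using autonomous_subset.crossing_down[OF dual, of \<tau> t s] tube[OF up(1)] assms by auto
qed

lemma level_mono:
  assumes "t \<in> S" "(t, s) \<in> R"
  shows "level \<C> t \<le> level \<C> s"
proof -
  have "{C \<in> \<C>. t \<notin> C} \<subseteq> {C \<in> \<C>. s \<notin> C}" using trace_down assms by blast
  then show ?thesis unfolding level_def using finite_chain by (intro card_mono) auto
qed

lemma crossing_cases:
  assumes "\<tau> \<in> T" "crosses S \<tau>"
  obtains (low) "\<tau> \<inter> below R S \<noteq> {}" "\<tau> \<inter> above R S = {}" "\<tau> \<inter> S \<in> \<C>"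
  | (up) "\<tau> \<inter> above R S \<noteq> {}" "\<tau> \<inter> below R S = {}" "S - \<tau> \<in> \<C>"
  using crossing_tube[OF tube[OF assms(1)] assms(2)] low_trace[OF assms] up_trace[OF assms] by blast

lemma saturated_trace:
  assumes "\<tau> \<in> T" "\<not> \<tau> \<subseteq> S"
  shows "saturated (\<tau> \<inter> S)"
proof (cases "crosses S \<tau>")
  case True
  show ?thesis
    using assms(1) True
  proof (cases rule: crossing_cases)
    case low
    then show ?thesis using saturated_chain by blast
  next
    case up
    have "S - (S - \<tau>) = \<tau> \<inter> S" by blast
    then show ?thesis using saturated_Diff[OF saturated_chain[OF up(3)]] by simp
  qed
next
  case False
  then have "\<tau> \<inter> S = {} \<or> \<tau> \<inter> S = S" using assms unfolding crosses_def by blast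
  then show ?thesis using saturated_empty saturated_S by auto
qed

text \<open>
  Crossing tubes are not contained in \<open>S\<close>, so each of them contains or avoids a tube inside \<open>S\<close>; such
  a tube therefore lies in a single layer.
\<close>

lemma level_const:
  assumes \<rho>: "\<rho> \<in> T" "\<rho> \<subseteq> S" and xy: "x \<in> \<rho>" "y \<in> \<rho>"
  shows "level \<C> x = level \<C> y"
proof -
  have "x \<in> C \<longleftrightarrow> y \<in> C" if "C \<in> \<C>" for C
    using that
  proof (cases rule: trace_cases)
    case (low \<tau>)
    then have "\<not> \<tau> \<subseteq> \<rho>" using \<rho> unfolding crosses_def by blast
    then show ?thesis using nested[OF \<rho>(1) low(1)] \<rho>(2) xy low(4) by blast
  next
    case (up \<tau>)
    then have "\<not> \<tau> \<subseteq> \<rho>" using \<rho> unfolding crosses_def by blast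
    then show ?thesis using nested[OF \<rho>(1) up(1)] \<rho>(2) xy up(4) by blast
  qed
  then have "{C \<in> \<C>. x \<notin> C} = {C \<in> \<C>. y \<notin> C}" by blast
  then show ?thesis by (simp add: level_def)
qed

lemma inside_saturated:
  assumes "\<rho> \<in> T" "\<rho> \<subseteq> S" "saturated X"
  shows "\<rho> \<subseteq> X \<or> \<rho> \<inter> X = {}"
proof (rule disjCI)
  assume "\<rho> \<inter> X \<noteq> {}"
  then obtain x where x: "x \<in> \<rho>" "x \<in> X" by blast
  show "\<rho> \<subseteq> X"
  proof
    fix y assume "y \<in> \<rho>"
    then have "level \<C> y = level \<C> x" "y \<in> S" using level_const[OF assms(1,2) _ x(1)] assms(2) by blast+
    then show "y \<in> X" using x(2) assms(3) unfolding saturated_def by blast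
  qed
qed

lemma reflect_inside [simp]: "\<tau> \<subseteq> S \<Longrightarrow> \<Phi> \<tau> = \<tau>"
  by (simp add: reflect_def)

lemma reflect_Diff: "\<not> \<tau> \<subseteq> S \<Longrightarrow> \<Phi> \<tau> - S = \<tau> - S"
  using mirror_subset[of "\<tau> \<inter> S"] by (auto simp: reflect_def)

lemma reflect_Int: "\<not> \<tau> \<subseteq> S \<Longrightarrow> \<Phi> \<tau> \<inter> S = mirror S \<C> (\<tau> \<inter> S)"
  using mirror_subset[of "\<tau> \<inter> S"] by (auto simp: reflect_def)

lemma reflect_subset_S_iff: "\<Phi> \<tau> \<subseteq> S \<longleftrightarrow> \<tau> \<subseteq> S"
  using reflect_Diff[of \<tau>] reflect_inside[of \<tau>] by blast

lemma split_subset: "\<sigma> \<subseteq> \<tau> \<longleftrightarrow> \<sigma> - S \<subseteq> \<tau> - S \<and> \<sigma> \<inter> S \<subseteq> \<tau> \<inter> S"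
  and split_disjoint: "\<sigma> \<inter> \<tau> = {} \<longleftrightarrow> (\<sigma> - S) \<inter> (\<tau> - S) = {} \<and> (\<sigma> \<inter> S) \<inter> (\<tau> \<inter> S) = {}"
  for \<sigma> \<tau> :: "'a set"
  by blast+

lemma reflect_subset_iff:
  assumes "\<sigma> \<in> T" "\<tau> \<in> T" "\<not> \<sigma> \<subseteq> S" "\<not> \<tau> \<subseteq> S"
  shows "\<Phi> \<sigma> \<subseteq> \<Phi> \<tau> \<longleftrightarrow> \<sigma> \<subseteq> \<tau>"
  unfolding split_subset[of "\<Phi> \<sigma>" "\<Phi> \<tau>"] split_subset[of \<sigma> \<tau>]
    reflect_Diff[OF assms(3)] reflect_Diff[OF assms(4)] reflect_Int[OF assms(3)] reflect_Int[OF assms(4)]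
    mirror_subset_iff[OF saturated_trace[OF assms(1,3)] saturated_trace[OF assms(2,4)]] ..

lemma reflect_disjoint_iff:
  assumes "\<sigma> \<in> T" "\<tau> \<in> T" "\<not> \<sigma> \<subseteq> S" "\<not> \<tau> \<subseteq> S"
  shows "\<Phi> \<sigma> \<inter> \<Phi> \<tau> = {} \<longleftrightarrow> \<sigma> \<inter> \<tau> = {}"
  unfolding split_disjoint[of "\<Phi> \<sigma>" "\<Phi> \<tau>"] split_disjoint[of \<sigma> \<tau>]
    reflect_Diff[OF assms(3)] reflect_Diff[OF assms(4)] reflect_Int[OF assms(3)] reflect_Int[OF assms(4)]
    mirror_disjoint_iff[OF saturated_trace[OF assms(1,3)] saturated_trace[OF assms(2,4)]] ..

lemma reflect_crosses_iff:
  assumes "\<tau> \<in> T"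
  shows "crosses S (\<Phi> \<tau>) \<longleftrightarrow> crosses S \<tau>"
proof (cases "\<tau> \<subseteq> S")
  case False
  have sat: "saturated (\<tau> \<inter> S)" by (rule saturated_trace[OF assms False])
  have "\<Phi> \<tau> \<inter> S = {} \<longleftrightarrow> \<tau> \<inter> S = {}"
    using mirror_eq_empty_iff[OF sat] reflect_Int[OF False] by simp
  moreover have "S \<subseteq> \<Phi> \<tau> \<longleftrightarrow> S \<subseteq> \<tau>"
    using S_subset_mirror_iff[OF sat] reflect_Int[OF False] by blast
  ultimately show ?thesis unfolding crosses_def reflect_subset_S_iff by blast
qed simp

lemma reflect_nested:
  assumes "\<sigma> \<in> T" "\<tau> \<in> T"
  shows "\<Phi> \<sigma> \<subseteq> \<Phi> \<tau> \<or> \<Phi> \<tau> \<subseteq> \<Phi> \<sigma> \<or> \<Phi> \<sigma> \<inter> \<Phi> \<tau> = {}"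
proof -
  have mixed: "\<rho> \<subseteq> \<Phi> \<tau> \<or> \<rho> \<inter> \<Phi> \<tau> = {}" if "\<rho> \<in> T" "\<tau> \<in> T" "\<rho> \<subseteq> S" "\<not> \<tau> \<subseteq> S" for \<rho> \<tau>
    using inside_saturated[OF that(1,3) saturated_mirror, of "\<tau> \<inter> S"] reflect_Int[OF that(4)] that(3)
    by blast
  show ?thesis
  proof (cases "\<sigma> \<subseteq> S"; cases "\<tau> \<subseteq> S")
    assume "\<sigma> \<subseteq> S" "\<tau> \<subseteq> S"
    then show ?thesis using nested[OF assms] by simp
  next
    assume "\<sigma> \<subseteq> S" "\<not> \<tau> \<subseteq> S"
    then show ?thesis using mixed[of \<sigma> \<tau>] assms by auto
  next
    assume "\<not> \<sigma> \<subseteq> S" "\<tau> \<subseteq> S"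
    then show ?thesis using mixed[of \<tau> \<sigma>] assms by auto
  next
    assume ns: "\<not> \<sigma> \<subseteq> S" "\<not> \<tau> \<subseteq> S"
    then show ?thesis
      using nested[OF assms] reflect_subset_iff[OF assms ns] reflect_subset_iff[OF assms(2,1) ns(2,1)]
        reflect_disjoint_iff[OF assms ns] by simp
  qed
qed

lemma mirror_low:
  assumes "\<tau> \<in> T" "\<tau> \<inter> S \<in> \<C>" "s \<in> mirror S \<C> (\<tau> \<inter> S)" "t \<in> S" "(t, s) \<in> flip S R"
  shows "t \<in> mirror S \<C> (\<tau> \<inter> S)"
proof -
  have "s \<in> S" using assms(3) mirror_subset by blast
  then have "(s, t) \<in> R" using assms(4,5) by (auto simp: flip_def)
  then have "level \<C> s \<le> level \<C> t" using level_mono \<open>s \<in> S\<close> by blast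
  moreover have down: "t \<in> \<tau> \<inter> S" if "s \<in> \<tau> \<inter> S" "t \<in> S" "level \<C> t \<le> level \<C> s" for s t
    by (rule chain_downward[OF assms(2) that(1,3)])
  ultimately show ?thesis using mirror_upward[of "\<tau> \<inter> S" s t] assms(3,4) by blast
qed

lemma mirror_up:
  assumes "\<tau> \<in> T" "S - \<tau> \<in> \<C>" "s \<in> mirror S \<C> (\<tau> \<inter> S)" "t \<in> S" "(s, t) \<in> flip S R"
  shows "t \<in> mirror S \<C> (\<tau> \<inter> S)"
proof -
  have "s \<in> S" using assms(3) mirror_subset by blast
  then have "(t, s) \<in> R" using assms(4,5) by (auto simp: flip_def)
  then have le: "level \<C> t \<le> level \<C> s" using level_mono assms(4) by blast
  have up: "t \<in> \<tau> \<inter> S" if "s \<in> \<tau> \<inter> S" "t \<in> S" "level \<C> s \<le> level \<C> t" for s t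
    using chain_downward[OF assms(2), of t s] that by blast
  show ?thesis using mirror_downward[of "\<tau> \<inter> S" s t] up assms(3,4) le by blast
qed

text \<open>
  Mirroring turns the down-set cut out by a tube that reaches below \<open>S\<close> into an up-set, which is a
  down-set of the flipped order; tubes that reach above \<open>S\<close> are treated in the reversed order.
\<close>

lemma reflect_tube:
  assumes "\<tau> \<in> T"
  shows "tube P (flip S R) (\<Phi> \<tau>)"
proof (cases "crosses S \<tau>")
  case False
  have "\<Phi> \<tau> = \<tau>"
  proof (cases "\<tau> \<subseteq> S")
    case ns: False
    then have "\<tau> \<inter> S = {} \<or> \<tau> \<inter> S = S" using False unfolding crosses_def by blast
    then show ?thesis using ns mirror_empty mirror_S by (auto simp: reflect_def)
  qed simp
  then show ?thesis using tube_flip_noncrossing[OF tube[OF assms] False] by simp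
next
  case True
  then have ns: "\<not> \<tau> \<subseteq> S" unfolding crosses_def by blast
  have sat: "saturated (\<tau> \<inter> S)" by (rule saturated_trace[OF assms ns])
  have ne: "mirror S \<C> (\<tau> \<inter> S) \<noteq> {}" "mirror S \<C> (\<tau> \<inter> S) \<subset> S"
    using mirror_eq_empty_iff[OF sat] S_subset_mirror_iff[OF sat] mirror_subset[of "\<tau> \<inter> S"] True
    unfolding crosses_def by blast+
  have eq: "\<Phi> \<tau> = (\<tau> - S) \<union> mirror S \<C> (\<tau> \<inter> S)" using ns by (simp add: reflect_def)
  show ?thesis
    using assms True
  proof (cases rule: crossing_cases)
    case low
    show ?thesis unfolding eq
      by (rule tube_flip_crossing[OF tube[OF assms] True low(1) ne]) (rule mirror_low[OF assms low(3)])
  next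
    case up
    have "tube P (flip S (R\<inverse>)) (\<Phi> \<tau>)"
      unfolding eq
    proof (rule autonomous_subset.tube_flip_crossing[OF dual _ True _ ne])
      show "tube P (R\<inverse>) \<tau>" using tube[OF assms] by simp
      show "\<tau> \<inter> above R S \<noteq> {}" by (rule up(1))
      show "t \<in> mirror S \<C> (\<tau> \<inter> S)"
        if "s \<in> mirror S \<C> (\<tau> \<inter> S)" "t \<in> S" "(t, s) \<in> flip S (R\<inverse>)" for s t
        using mirror_up[OF assms up(3) that(1,2)] that(3) by (simp add: flip_converse)
    qed
    then show ?thesis by (simp add: flip_converse)
  qed
qed

text \<open>
  This is what makes the construction invertible: the chain of the reflected tubing determines the
  same opposition of layers.
\<close>

lemma traces_reflect: "traces (flip S R) S (\<Phi> ` T) = (\<lambda>C. S - C) ` \<C>"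
proof -
  have outside: "\<Phi> \<tau> \<inter> below Q S \<noteq> {} \<longleftrightarrow> \<tau> \<inter> below Q S \<noteq> {}" if "crosses S \<tau>" for \<tau> Q
  proof -
    have "\<Phi> \<tau> - S = \<tau> - S" using reflect_Diff that unfolding crosses_def by blast
    then show ?thesis unfolding below_def by blast
  qed
  let ?L = "{\<tau> \<in> T. crosses S \<tau> \<and> \<tau> \<inter> below R S \<noteq> {}}" and ?U = "{\<tau> \<in> T. crosses S \<tau> \<and> \<tau> \<inter> above R S \<noteq> {}}"
  have 1: "{\<tau> \<in> \<Phi> ` T. crosses S \<tau> \<and> \<tau> \<inter> below Q S \<noteq> {}} = \<Phi> ` {\<tau> \<in> T. crosses S \<tau> \<and> \<tau> \<inter> below Q S \<noteq> {}}" for Q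
  proof -
    have "crosses S (\<Phi> \<tau>) \<and> \<Phi> \<tau> \<inter> below Q S \<noteq> {} \<longleftrightarrow> crosses S \<tau> \<and> \<tau> \<inter> below Q S \<noteq> {}"
      if "\<tau> \<in> T" for \<tau>
      using reflect_crosses_iff[OF that] outside by blast
    then show ?thesis by blast
  qed
  have "traces (flip S R) S (\<Phi> ` T) = (\<lambda>\<tau>. \<Phi> \<tau> \<inter> S) ` ?L \<union> (\<lambda>\<tau>. S - \<Phi> \<tau>) ` ?U"
    unfolding traces_def[of "flip S R"] below_flip above_flip 1 image_image ..
  also have "(\<lambda>\<tau>. \<Phi> \<tau> \<inter> S) ` ?L = (\<lambda>C. mirror S \<C> C) ` (\<lambda>\<tau>. \<tau> \<inter> S) ` ?L"
    unfolding image_image by (rule image_cong[OF refl], rule reflect_Int) (auto simp: crosses_def)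
  also have "(\<lambda>\<tau>. S - \<Phi> \<tau>) ` ?U = (\<lambda>C. mirror S \<C> C) ` (\<lambda>\<tau>. S - \<tau>) ` ?U"
    unfolding image_image
  proof (rule image_cong[OF refl])
    fix \<tau> assume \<tau>: "\<tau> \<in> ?U"
    then have ns: "\<not> \<tau> \<subseteq> S" by (auto simp: crosses_def)
    have "S - \<Phi> \<tau> = S - \<Phi> \<tau> \<inter> S" by blast
    also have "\<dots> = mirror S \<C> (S - \<tau> \<inter> S)"
      using mirror_Diff[OF saturated_trace[of \<tau>]] \<tau> ns by (simp add: reflect_Int)
    also have "S - \<tau> \<inter> S = S - \<tau>" by blast
    finally show "S - \<Phi> \<tau> = mirror S \<C> (S - \<tau>)" .
  qed
  also have "(\<lambda>C. mirror S \<C> C) ` (\<lambda>\<tau>. \<tau> \<inter> S) ` ?L \<union> (\<lambda>C. mirror S \<C> C) ` (\<lambda>\<tau>. S - \<tau>) ` ?U =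
      (\<lambda>C. mirror S \<C> C) ` \<C>"
  proof -
    have "(\<lambda>\<tau>. \<tau> \<inter> S) ` ?L \<union> (\<lambda>\<tau>. S - \<tau>) ` ?U = \<C>" unfolding traces_def ..
    then show ?thesis by (simp only: image_Un[symmetric])
  qed
  also have "\<dots> = (\<lambda>C. S - C) ` (\<lambda>C. S - mirror S \<C> C) ` \<C>"
    unfolding image_image by (rule image_cong[OF refl]) (use mirror_subset in blast)
  also have "\<dots> = (\<lambda>C. S - C) ` \<C>" by (simp only: image_Diff_mirror)
  finally show ?thesis .
qed

lemma reflect_reflect:
  assumes "\<tau> \<in> T"
  shows "reflect S (traces (flip S R) S (\<Phi> ` T)) (\<Phi> \<tau>) = \<tau>"
proof (cases "\<tau> \<subseteq> S")
  case True
  then show ?thesis by (simp add: reflect_def)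
next
  case False
  have "\<not> \<Phi> \<tau> \<subseteq> S" using False by (simp add: reflect_subset_S_iff)
  then have "reflect S (traces (flip S R) S (\<Phi> ` T)) (\<Phi> \<tau>) =
      (\<Phi> \<tau> - S) \<union> mirror S ((\<lambda>C. S - C) ` \<C>) (\<Phi> \<tau> \<inter> S)"
    unfolding traces_reflect by (simp add: reflect_def)
  also have "\<dots> = (\<tau> - S) \<union> mirror S \<C> (mirror S \<C> (\<tau> \<inter> S))"
    using False mirror_Diff_image[OF mirror_subset] by (simp add: reflect_Diff reflect_Int)
  also have "\<dots> = \<tau>" using mirror_mirror[OF saturated_trace[OF assms False]] by auto
  finally show ?thesis .
qed

text \<open>
  Among tubes not contained in \<open>S\<close>, edges are not lost by undoing the reflection: an edge between
  disjoint tubes that uses an element of \<open>S\<close> exists for any other nonempty trace, except between two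
  crossing tubes, where it always points from the one reaching below \<open>S\<close> to the one reaching above.
\<close>

lemma reflect_acyclic: "acyclic (tubing_digraph (flip S R) (\<Phi> ` T))"
proof (rule autonomous_subset.acyclic_tubing_digraph_split[OF flipped])
  show "tube P (flip S R) \<tau>" if "\<tau> \<in> \<Phi> ` T" for \<tau>
    using that reflect_tube by blast
  show "\<sigma> \<subseteq> \<tau> \<or> \<tau> \<subseteq> \<sigma> \<or> \<sigma> \<inter> \<tau> = {}" if "\<sigma> \<in> \<Phi> ` T" "\<tau> \<in> \<Phi> ` T" for \<sigma> \<tau>
    using that reflect_nested by blast
  have "\<Phi> ` T \<inter> Pow S = T \<inter> Pow S"
  proof
    show "\<Phi> ` T \<inter> Pow S \<subseteq> T \<inter> Pow S" using reflect_subset_S_iff by auto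
    show "T \<inter> Pow S \<subseteq> \<Phi> ` T \<inter> Pow S"
    proof
      fix \<tau> assume "\<tau> \<in> T \<inter> Pow S"
      then have "\<Phi> \<tau> = \<tau>" "\<tau> \<in> T" "\<tau> \<subseteq> S" by auto
      then show "\<tau> \<in> \<Phi> ` T \<inter> Pow S" by (metis IntI PowI imageI)
    qed
  qed
  moreover have "tubing_digraph (flip S R) (T \<inter> Pow S) \<subseteq> (tubing_digraph R T)\<inverse>"
  proof
    fix e assume "e \<in> tubing_digraph (flip S R) (T \<inter> Pow S)"
    then obtain \<sigma> \<tau> x y where e: "e = (\<sigma>, \<tau>)" "\<sigma> \<in> T" "\<tau> \<in> T" "\<sigma> \<subseteq> S" "\<tau> \<subseteq> S" "\<sigma> \<inter> \<tau> = {}"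
      "x \<in> \<sigma>" "y \<in> \<tau>" "(x, y) \<in> flip S R"
      unfolding tubing_digraph_def by blast
    then have "(y, x) \<in> R" by (auto simp: flip_def split: if_splits)
    then show "e \<in> (tubing_digraph R T)\<inverse>" using edgeI[of \<tau> \<sigma> y x] e by blast
  qed
  ultimately show "acyclic (tubing_digraph (flip S R) (\<Phi> ` T \<inter> Pow S))"
    using acyclic by (metis acyclic_converse acyclic_subset)
  define \<psi> where "\<psi> = reflect S (traces (flip S R) S (\<Phi> ` T))"
  have edge: "(\<psi> a, \<psi> b) \<in> tubing_digraph R T" if ab: "(a, b) \<in> tubing_digraph (flip S R) (\<Phi> ` T - Pow S)" for a b
  proof -
    obtain \<sigma> \<tau> x y where st: "a = \<Phi> \<sigma>" "b = \<Phi> \<tau>" "\<sigma> \<in> T" "\<tau> \<in> T" "\<not> \<Phi> \<sigma> \<subseteq> S" "\<not> \<Phi> \<tau> \<subseteq> S"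
      "\<Phi> \<sigma> \<inter> \<Phi> \<tau> = {}" and xy: "x \<in> \<Phi> \<sigma>" "y \<in> \<Phi> \<tau>" "(x, y) \<in> flip S R"
    proof -
      have ab': "a \<in> \<Phi> ` T" "b \<in> \<Phi> ` T" "\<not> a \<subseteq> S" "\<not> b \<subseteq> S" "a \<inter> b = {}"
        "\<exists>x\<in>a. \<exists>y\<in>b. (x, y) \<in> flip S R"
        using ab unfolding tubing_digraph_def by blast+
      then obtain \<sigma> \<tau> where "a = \<Phi> \<sigma>" "b = \<Phi> \<tau>" "\<sigma> \<in> T" "\<tau> \<in> T" by blast
      with ab' that show ?thesis by blast
    qed
    have ns: "\<not> \<sigma> \<subseteq> S" "\<not> \<tau> \<subseteq> S" using st by (simp_all add: reflect_subset_S_iff)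
    have disj: "\<sigma> \<inter> \<tau> = {}" using st reflect_disjoint_iff[OF st(3,4) ns] by blast
    have meets: "\<upsilon> \<inter> S \<noteq> {}" if \<upsilon>: "\<not> \<upsilon> \<subseteq> S" "z \<in> \<Phi> \<upsilon>" "z \<in> S" for z \<upsilon>
    proof
      assume "\<upsilon> \<inter> S = {}"
      then have "\<Phi> \<upsilon> \<inter> S = {}" using reflect_Int[OF \<upsilon>(1)] mirror_empty by simp
      then show False using \<upsilon> by blast
    qed
    have off: "z \<in> \<upsilon>" if "\<not> \<upsilon> \<subseteq> S" "z \<in> \<Phi> \<upsilon>" "z \<notin> S" for z \<upsilon>
      using that reflect_Diff[OF that(1)] by blast
    have "(\<sigma>, \<tau>) \<in> tubing_digraph R T"
    proof (cases "x \<in> S"; cases "y \<in> S")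
      assume "x \<notin> S" "y \<notin> S"
      then show ?thesis using edgeI[OF st(3,4) disj, of x y] off[OF ns(1) xy(1)] off[OF ns(2) xy(2)] xy(3)
        by (simp add: flip_def)
    next
      assume S: "x \<in> S" "y \<notin> S"
      then have "(x, y) \<in> R" using xy by (auto simp: flip_def)
      then have "y \<in> above R S" using above_iff[OF S] by blast
      moreover obtain z where z: "z \<in> \<sigma>" "z \<in> S" using meets[OF ns(1) xy(1) S(1)] by blast
      ultimately have "(z, y) \<in> R" using above_iff[OF z(2) S(2)] by blast
      then show ?thesis using edgeI[OF st(3,4) disj z(1) off[OF ns(2) xy(2) S(2)]] by blast
    next
      assume S: "x \<notin> S" "y \<in> S"
      then have "(x, y) \<in> R" using xy by (auto simp: flip_def)
      then have "x \<in> below R S" using below_iff[OF S(2,1)] by blast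
      then show ?thesis
        using low_edge[OF st(3,4) disj] off[OF ns(1) xy(1) S(1)] meets[OF ns(2) xy(2) S(2)] by blast
    next
      assume S: "x \<in> S" "y \<in> S"
      have m: "\<sigma> \<inter> S \<noteq> {}" "\<tau> \<inter> S \<noteq> {}"
        using meets[OF ns(1) xy(1) S(1)] meets[OF ns(2) xy(2) S(2)] by blast+
      have c: "crosses S \<sigma>" "crosses S \<tau>" using m ns disj unfolding crosses_def by blast+
      show ?thesis
      proof (cases "\<sigma> \<inter> below R S \<noteq> {}")
        case True
        then show ?thesis using low_edge[OF st(3,4) disj _ m(2)] by blast
      next
        case False
        then have "S - \<sigma> \<in> \<C>" using crossing_cases[OF st(3) c(1)] by metis
        moreover have "x \<in> mirror S \<C> (\<sigma> \<inter> S)" using xy(1) S(1) reflect_Int[OF ns(1)] by blast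
        ultimately have "y \<in> mirror S \<C> (\<sigma> \<inter> S)" using mirror_up[OF st(3) _ _ S(2) xy(3)] by blast
        then have "y \<in> \<Phi> \<sigma>" using reflect_Int[OF ns(1)] by blast
        then show ?thesis using st(7) xy(2) by blast
      qed
    qed
    then show ?thesis using reflect_reflect st unfolding \<psi>_def by simp
  qed
  show "acyclic (tubing_digraph (flip S R) (\<Phi> ` T - Pow S))"
    by (rule acyclic_vimage[OF acyclic edge])
qed

lemma reflect_tubing: "tubing P (flip S R) (\<Phi> ` T)"
  unfolding tubing_def
proof (intro conjI ballI)
  show "tube P (flip S R) \<tau>" if "\<tau> \<in> \<Phi> ` T" for \<tau>
    using that reflect_tube by blast
  show "\<sigma> \<subseteq> \<tau> \<or> \<tau> \<subseteq> \<sigma> \<or> \<sigma> \<inter> \<tau> = {}" if "\<sigma> \<in> \<Phi> ` T" "\<tau> \<in> \<Phi> ` T" for \<sigma> \<tau>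
    using that reflect_nested by blast
qed (rule reflect_acyclic)

lemma card_reflect: "card (\<Phi> ` T) = card T"
  by (rule card_image, rule inj_on_inverseI, rule reflect_reflect)

lemma reflect_reflect_image: "reflect S (traces (flip S R) S (\<Phi> ` T)) ` \<Phi> ` T = T"
  unfolding image_image using reflect_reflect by simp

end

lemma finite_tubings: "finite P \<Longrightarrow> finite {T. tubing P R T \<and> card T = k}"
  by (rule finite_subset[of _ "Pow (Pow P)"]) (auto simp: tubing_def tube_def)

lemma (in autonomous_subset) card_tubings_le_flip:
  assumes "S \<noteq> {}"
  shows "card {T. tubing P R T \<and> card T = k} \<le> card {T. tubing P (flip S R) T \<and> card T = k}"
proof (rule card_inj_on_le[where f = "\<lambda>T. reflect S (traces R S T) ` T"])
  have at: "tubing_at P R S T" if "tubing P R T" for T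
    using that assms autonomous_subset_axioms unfolding tubing_at_def tubing_at_axioms_def by blast
  show "inj_on (\<lambda>T. reflect S (traces R S T) ` T) {T. tubing P R T \<and> card T = k}"
    by (rule inj_on_inverseI[where g = "\<lambda>T. reflect S (traces (flip S R) S T) ` T"])
      (use tubing_at.reflect_reflect_image[OF at] in blast)
  show "(\<lambda>T. reflect S (traces R S T) ` T) ` {T. tubing P R T \<and> card T = k}
      \<subseteq> {T. tubing P (flip S R) T \<and> card T = k}"
    using tubing_at.reflect_tubing[OF at] tubing_at.card_reflect[OF at] by auto
  show "finite {T. tubing P (flip S R) T \<and> card T = k}"
    by (rule finite_tubings[OF finite_P])
qed

text \<open>
  Reflection is injective and preserves the number of tubes. Flipping twice restores the order, so
  the inequality holds in both directions.
\<close>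

theorem card_tubings_flip:
  assumes "autonomous_subset P R S"
  shows "card {T. tubing P (flip S R) T \<and> card T = k} = card {T. tubing P R T \<and> card T = k}"
proof (cases "S = {}")
  case True
  then have "flip S R = R" by (simp add: flip_def)
  then show ?thesis by simp
next
  case False
  have "card {T. tubing P (flip S R) T \<and> card T = k} \<le> card {T. tubing P (flip S (flip S R)) T \<and> card T = k}"
    by (rule autonomous_subset.card_tubings_le_flip[OF autonomous_subset.flipped[OF assms] False])
  then show ?thesis
    using autonomous_subset.card_tubings_le_flip[OF assms False, of k] by simp
qed

theorem card_tubings_comparability_graph:
  assumes "finite P" "strict_order_on P R" "strict_order_on P Q"
    and "comparability_graph R = comparability_graph Q"
  shows "card {T. tubing P R T \<and> card T = k} = card {T. tubing P Q T \<and> card T = k}"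
proof -
  have "flips P R Q" by (rule flips_if_same_comparability_graph[OF assms])
  then have "strict_order_on P Q \<and> card {T. tubing P R T \<and> card T = k} = card {T. tubing P Q T \<and> card T = k}"
  proof (induction rule: flips.induct)
    case flips_refl
    then show ?case using assms by simp
  next
    case (flips_step Q S)
    have "autonomous_subset P Q S"
      using flips_step assms(1) unfolding autonomous_subset_def by blast
    then show ?case
      using card_tubings_flip[of P Q S k] strict_order_flip[of P Q S] flips_step by simp
  qed
  then show ?thesis by blast
qed

section \<open>Comparability invariance of the number of tubings\<close>

lemma strict_order_Diff_Id: "partial_order_on P r \<Longrightarrow> strict_order_on P (r - Id)"
  using trans_diff_Id[of r] partial_order_onD[of P r] by (auto simp: strict_order_on_def irrefl_def)

lemma comparability_graph_Diff_Id [simp]: "comparability_graph (r - Id) = comparability_graph r"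
  by (auto simp: comparability_graph_def)

lemma tubing_digraph_Diff_Id [simp]: "tubing_digraph (r - Id) T = tubing_digraph r T"
  by (simp add: tubing_digraph_def)

lemma order_convex_Diff_Id [simp]: "order_convex P (r - Id) S \<longleftrightarrow> order_convex P r S"
proof -
  have "((x, y) \<in> r \<and> (y, z) \<in> r \<longrightarrow> y \<in> S) \<longleftrightarrow>
      ((x, y) \<in> r - Id \<and> (y, z) \<in> r - Id \<longrightarrow> y \<in> S)" if "x \<in> S" "z \<in> S" for x y z
    using that by auto
  then show ?thesis unfolding order_convex_def by blast
qed

text \<open>
  Refine a comparability by intermediate elements until only covering pairs remain; convexity keeps
  the intermediate elements inside \<open>\<tau>\<close>.
\<close>

lemma hasse_path:
  assumes "finite P" and R: "strict_order_on P (r - Id)"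
    and \<tau>: "order_convex P r \<tau>" and xy: "(x, y) \<in> r - Id" "x \<in> \<tau>" "y \<in> \<tau>"
  shows "(x, y) \<in> (hasse_diagram r \<inter> \<tau> \<times> \<tau>)\<^sup>*"
  using xy
proof (induction "card {z. (x, z) \<in> r - Id \<and> (z, y) \<in> r - Id}" arbitrary: x y rule: less_induct)
  case less
  let ?R = "r - Id"
  let ?I = "\<lambda>x y. {z. (x, z) \<in> ?R \<and> (z, y) \<in> ?R}"
  have trans: "(a, c) \<in> ?R" if "(a, b) \<in> ?R" "(b, c) \<in> ?R" for a b c
    using R that unfolding strict_order_on_def by (meson transD)
  have irr: "(a, a) \<notin> ?R" for a by simp
  have inP: "a \<in> P \<and> b \<in> P" if "(a, b) \<in> ?R" for a b
    using R that unfolding strict_order_on_def by blast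
  have fin: "finite (?I a b)" for a b
    by (rule finite_subset[OF _ \<open>finite P\<close>]) (use inP in blast)
  show ?case
  proof (cases "?I x y = {}")
    case True
    then have "(x, y) \<in> covering_relation r" using less.prems by (auto simp: covering_relation_def)
    then show ?thesis using less.prems by (auto simp: hasse_diagram_def)
  next
    case False
    then obtain z where z: "(x, z) \<in> ?R" "(z, y) \<in> ?R" by blast
    have "z \<in> \<tau>"
      using \<tau> less.prems z inP[OF z(1)] unfolding order_convex_def by blast
    have "?I x z \<subset> ?I x y"
    proof
      show "?I x z \<subseteq> ?I x y" using trans[OF _ z(2)] by blast
      show "?I x z \<noteq> ?I x y" using z irr[of z] by blast
    qed
    moreover have "?I z y \<subset> ?I x y"
    proof
      show "?I z y \<subseteq> ?I x y" using trans[OF z(1)] by blast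
      show "?I z y \<noteq> ?I x y" using z irr[of z] by blast
    qed
    ultimately have "card (?I x z) < card (?I x y)" "card (?I z y) < card (?I x y)"
      by - (rule psubset_card_mono[OF fin], assumption)+
    then have "(x, z) \<in> (hasse_diagram r \<inter> \<tau> \<times> \<tau>)\<^sup>*" "(z, y) \<in> (hasse_diagram r \<inter> \<tau> \<times> \<tau>)\<^sup>*"
      using less.hyps[of x z] less.hyps[of z y] z less.prems \<open>z \<in> \<tau>\<close> by blast+
    then show ?thesis by (rule rtrancl_trans)
  qed
qed

lemma hasse_connected_iff:
  assumes "finite P" "strict_order_on P (r - Id)" "order_convex P r \<tau>"
  shows "connected_induced_subgraph (hasse_diagram r) \<tau> \<longleftrightarrow>
    connected_induced_subgraph (comparability_graph r) \<tau>"
proof -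
  let ?H = "hasse_diagram r \<inter> \<tau> \<times> \<tau>" and ?C = "comparability_graph r \<inter> \<tau> \<times> \<tau>"
  have "?H \<subseteq> ?C"
    by (auto simp: hasse_diagram_def covering_relation_def comparability_graph_def)
  then have 1: "?H\<^sup>* \<subseteq> ?C\<^sup>*" by (rule rtrancl_mono)
  have "sym ?H" by (auto simp: sym_def hasse_diagram_def)
  then have sym: "sym (?H\<^sup>*)" by (rule sym_rtrancl)
  have "?C \<subseteq> ?H\<^sup>*"
  proof (rule subrelI)
    fix x y assume "(x, y) \<in> ?C"
    then have "(x, y) \<in> r - Id \<or> (y, x) \<in> r - Id" "x \<in> \<tau>" "y \<in> \<tau>"
      by (auto simp: comparability_graph_def)
    then show "(x, y) \<in> ?H\<^sup>*"
      using hasse_path[OF assms, of x y] hasse_path[OF assms, of y x] symD[OF sym, of y x] by blast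
  qed
  then have "?C\<^sup>* \<subseteq> ?H\<^sup>*" by (rule rtrancl_subset_rtrancl)
  with 1 have "?C\<^sup>* = ?H\<^sup>*" by blast
  then show ?thesis unfolding connected_induced_subgraph_def by simp
qed

lemma proper_tubing_iff_tubing:
  assumes "finite P" "partial_order_on P r"
  shows "proper_tubing P r T \<longleftrightarrow> tubing P (r - Id) T"
proof -
  have "proper_tube P r \<tau> \<longleftrightarrow> tube P (r - Id) \<tau>" for \<tau>
    unfolding proper_tube_def tube_def
    using hasse_connected_iff[OF assms(1) strict_order_Diff_Id[OF assms(2)], of \<tau>] by auto
  then show ?thesis by (simp add: proper_tubing_def tubing_def)
qed

lemma tube_image:
  assumes f: "inj_on f P" "f ` P = P'"
    and R: "\<And>x y. x \<in> P \<Longrightarrow> y \<in> P \<Longrightarrow> (x, y) \<in> R \<longleftrightarrow> (f x, f y) \<in> R'"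
    and \<tau>: "tube P R \<tau>"
  shows "tube P' R' (f ` \<tau>)"
proof -
  have \<tau>P: "\<tau> \<subset> P" using \<tau> by (simp add: tube_def)
  have "f ` \<tau> \<noteq> f ` P"
    using inj_on_image_eq_iff[OF f(1), of \<tau> P] \<tau>P by blast
  then have "f ` \<tau> \<subset> P'" using \<tau>P f(2) by blast
  moreover have "card (f ` \<tau>) = card \<tau>"
    using f(1) \<tau>P by (meson card_image inj_on_subset psubset_imp_subset)
  moreover have "order_convex P' R' (f ` \<tau>)"
    unfolding order_convex_def
  proof (intro ballI impI)
    fix a c b assume "a \<in> f ` \<tau>" "c \<in> f ` \<tau>" "b \<in> P'" and abc: "(a, b) \<in> R' \<and> (b, c) \<in> R'"
    then obtain x z y where xyz: "x \<in> \<tau>" "z \<in> \<tau>" "y \<in> P" "a = f x" "c = f z" "b = f y"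
      using f(2) by blast
    moreover from this have "x \<in> P" "z \<in> P" using \<tau>P by blast+
    ultimately have "(x, y) \<in> R" "(y, z) \<in> R" using R abc by simp_all
    then have "y \<in> \<tau>" by (rule tube_convex[OF \<tau> xyz(1,2,3)])
    then show "b \<in> f ` \<tau>" using xyz by simp
  qed
  moreover have "connected_induced_subgraph (comparability_graph R') (f ` \<tau>)"
  proof -
    let ?E = "comparability_graph R \<inter> \<tau> \<times> \<tau>" and ?E' = "comparability_graph R' \<inter> f ` \<tau> \<times> f ` \<tau>"
    have "(f x, f y) \<in> ?E'\<^sup>*" if "(x, y) \<in> ?E\<^sup>*" for x y
      using that
    proof (induction rule: rtrancl_induct)
      case (step y z)
      then have yz: "y \<in> \<tau>" "z \<in> \<tau>" "y \<noteq> z" "(y, z) \<in> R \<or> (z, y) \<in> R"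
        by (auto simp: comparability_graph_def)
      moreover from this have "y \<in> P" "z \<in> P" using \<tau>P by blast+
      ultimately have "(f y, f z) \<in> ?E'"
        using R f(1) by (auto simp: comparability_graph_def inj_on_def)
      then show ?case by (rule rtrancl_into_rtrancl[OF step(3)])
    qed simp
    then show ?thesis using \<tau> unfolding tube_def connected_induced_subgraph_def by blast
  qed
  ultimately show ?thesis using \<tau> by (simp add: tube_def)
qed

lemma tubing_image:
  assumes f: "inj_on f P" "f ` P = P'"
    and R: "\<And>x y. x \<in> P \<Longrightarrow> y \<in> P \<Longrightarrow> (x, y) \<in> R \<longleftrightarrow> (f x, f y) \<in> R'"
    and T: "tubing P R T"
  shows "tubing P' R' ((`) f ` T)"
proof -
  have TP: "\<tau> \<subseteq> P" if "\<tau> \<in> T" for \<tau> using T that by (auto simp: tubing_def tube_def)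
  define \<psi> where "\<psi> \<sigma> = {x \<in> P. f x \<in> \<sigma>}" for \<sigma>
  have \<psi>: "\<psi> (f ` \<tau>) = \<tau>" if "\<tau> \<in> T" for \<tau>
    unfolding \<psi>_def using TP[OF that] f(1) by (auto simp: inj_on_def)
  have "acyclic (tubing_digraph R' ((`) f ` T))"
  proof (rule acyclic_vimage)
    show "acyclic (tubing_digraph R T)" using T by (simp add: tubing_def)
    fix a b assume "(a, b) \<in> tubing_digraph R' ((`) f ` T)"
    then have ab: "a \<in> (`) f ` T" "b \<in> (`) f ` T" "a \<inter> b = {}" "\<exists>x\<in>a. \<exists>y\<in>b. (x, y) \<in> R' - Id"
      unfolding tubing_digraph_def by blast+
    then obtain \<sigma> \<tau> where st: "a = f ` \<sigma>" "b = f ` \<tau>" "\<sigma> \<in> T" "\<tau> \<in> T" by blast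
    then obtain x y where xy: "x \<in> \<sigma>" "y \<in> \<tau>" "(f x, f y) \<in> R'" "f x \<noteq> f y" using ab(4) by blast
    then have "x \<in> P" "y \<in> P" using TP st by blast+
    then have "(x, y) \<in> R - Id" using R[of x y] xy by auto
    moreover have "\<sigma> \<inter> \<tau> = {}" using ab(3) st by blast
    ultimately show "(\<psi> a, \<psi> b) \<in> tubing_digraph R T"
      unfolding st(1,2) \<psi>[OF st(3)] \<psi>[OF st(4)] tubing_digraph_def using st(3,4) xy(1,2) by blast
  qed
  moreover have "\<sigma> \<subseteq> \<tau> \<or> \<tau> \<subseteq> \<sigma> \<or> \<sigma> \<inter> \<tau> = {}" if images: "\<sigma> \<in> (`) f ` T" "\<tau> \<in> (`) f ` T" for \<sigma> \<tau>
  proof -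
    obtain \<sigma>' \<tau>' where st: "\<sigma> = f ` \<sigma>'" "\<tau> = f ` \<tau>'" "\<sigma>' \<in> T" "\<tau>' \<in> T" using images by blast
    then have "\<sigma>' \<subseteq> \<tau>' \<or> \<tau>' \<subseteq> \<sigma>' \<or> \<sigma>' \<inter> \<tau>' = {}" using T by (simp add: tubing_def)
    moreover have "f ` \<sigma>' \<inter> f ` \<tau>' = f ` (\<sigma>' \<inter> \<tau>')"
      using inj_on_image_Int[OF f(1)] TP st by metis
    ultimately show ?thesis using st by auto
  qed
  moreover have "tube P' R' \<tau>" if "\<tau> \<in> (`) f ` T" for \<tau>
    using that tube_image[OF f R] T by (auto simp: tubing_def)
  ultimately show ?thesis unfolding tubing_def by blast
qed

lemma card_tubings_le_image:
  assumes f: "bij_betw f P P'" and "finite P'"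
    and R: "\<And>x y. x \<in> P \<Longrightarrow> y \<in> P \<Longrightarrow> (x, y) \<in> R \<longleftrightarrow> (f x, f y) \<in> R'"
  shows "card {T. tubing P R T \<and> card T = k} \<le> card {T. tubing P' R' T \<and> card T = k}"
proof (rule card_inj_on_le[where f = "(`) ((`) f)"])
  have inj: "inj_on f P" and img: "f ` P = P'" using f by (simp_all add: bij_betw_def)
  have inj2: "inj_on ((`) f) (Pow P)" by (rule inj_on_image_Pow[OF inj])
  have sub: "T \<subseteq> Pow P" if "tubing P R T" for T using that by (auto simp: tubing_def tube_def)
  show "inj_on ((`) ((`) f)) {T. tubing P R T \<and> card T = k}"
    by (rule inj_on_subset[OF inj_on_image_Pow[OF inj2]]) (use sub in blast)
  show "(`) ((`) f) ` {T. tubing P R T \<and> card T = k} \<subseteq> {T. tubing P' R' T \<and> card T = k}"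
  proof
    fix U assume "U \<in> (`) ((`) f) ` {T. tubing P R T \<and> card T = k}"
    then obtain T where T: "U = (`) f ` T" "tubing P R T" "card T = k" by blast
    moreover have "card ((`) f ` T) = card T" by (rule card_image[OF inj_on_subset[OF inj2 sub[OF T(2)]]])
    ultimately show "U \<in> {T. tubing P' R' T \<and> card T = k}"
      using tubing_image[OF inj img R] by simp
  qed
  show "finite {T. tubing P' R' T \<and> card T = k}" by (rule finite_tubings[OF assms(2)])
qed

lemma card_tubings_isomorphic:
  assumes f: "bij_betw f P P'" and "finite P"
    and R: "\<And>x y. x \<in> P \<Longrightarrow> y \<in> P \<Longrightarrow> (x, y) \<in> R \<longleftrightarrow> (f x, f y) \<in> R'"
  shows "card {T. tubing P R T \<and> card T = k} = card {T. tubing P' R' T \<and> card T = k}"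
proof (rule antisym)
  have "finite P'" using f \<open>finite P\<close> bij_betw_finite by blast
  then show "card {T. tubing P R T \<and> card T = k} \<le> card {T. tubing P' R' T \<and> card T = k}"
    using card_tubings_le_image[OF f _ R] by blast
  let ?g = "the_inv_into P f"
  have g: "bij_betw ?g P' P" by (rule bij_betw_the_inv_into[OF f])
  have fg: "f (?g y) = y" if "y \<in> P'" for y by (rule f_the_inv_into_f_bij_betw[OF f that])
  have gP: "?g y \<in> P" if "y \<in> P'" for y by (rule bij_betwE[OF g, rule_format, OF that])
  show "card {T. tubing P' R' T \<and> card T = k} \<le> card {T. tubing P R T \<and> card T = k}"
  proof (rule card_tubings_le_image[OF g \<open>finite P\<close>])
    show "(x, y) \<in> R' \<longleftrightarrow> (?g x, ?g y) \<in> R" if "x \<in> P'" "y \<in> P'" for x y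
      using R[OF gP[OF that(1)] gP[OF that(2)]] fg[OF that(1)] fg[OF that(2)] by simp
  qed
qed

theorem card_proper_tubings_comparability_invariant:
  assumes fin: "finite P" and po: "partial_order_on P r" "partial_order_on P' r'"
    and iso: "graph_isomorphic P (comparability_graph r) P' (comparability_graph r')"
  shows "card {T. proper_tubing P r T \<and> card T = k} = card {T. proper_tubing P' r' T \<and> card T = k}"
proof -
  obtain f where f: "bij_betw f P P'"
    and fE: "\<And>x y. x \<in> P \<Longrightarrow> y \<in> P \<Longrightarrow>
      (x, y) \<in> comparability_graph r \<longleftrightarrow> (f x, f y) \<in> comparability_graph r'"
    using iso unfolding graph_isomorphic_def by blast
  have fin': "finite P'" using f fin bij_betw_finite by blast
  have R: "strict_order_on P (r - Id)" and R': "strict_order_on P' (r' - Id)"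
    using po by (simp_all add: strict_order_Diff_Id)
  \<comment> \<open>The second order, pulled back to the ground set of the first one.\<close>
  define Q where "Q = {(x, y) \<in> P \<times> P. (f x, f y) \<in> r' - Id}"
  have Q: "strict_order_on P Q"
  proof -
    have "trans Q"
    proof (rule transI)
      fix x y z assume "(x, y) \<in> Q" "(y, z) \<in> Q"
      then have "x \<in> P" "z \<in> P" "(f x, f y) \<in> r' - Id" "(f y, f z) \<in> r' - Id" by (auto simp: Q_def)
      moreover have "trans (r' - Id)" using R' by (simp add: strict_order_on_def)
      ultimately have "x \<in> P \<and> z \<in> P \<and> (f x, f z) \<in> r' - Id" by (meson transD)
      then show "(x, z) \<in> Q" unfolding Q_def by blast
    qed
    then show ?thesis by (auto simp: strict_order_on_def irrefl_def Q_def)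
  qed
  have "comparability_graph Q = comparability_graph (r - Id)"
  proof -
    have "(x, y) \<in> comparability_graph Q \<longleftrightarrow> (x, y) \<in> comparability_graph r" for x y
    proof (cases "x \<in> P \<and> y \<in> P")
      case True
      then have "f x = f y \<longleftrightarrow> x = y" using f by (auto simp: bij_betw_def inj_on_def)
      then have "(x, y) \<in> comparability_graph Q \<longleftrightarrow> (f x, f y) \<in> comparability_graph r'"
        using True by (auto simp: Q_def comparability_graph_def)
      then show ?thesis using fE True by blast
    next
      case False
      then show ?thesis using partial_order_onD(4)[OF po(1)] by (auto simp: Q_def comparability_graph_def)
    qed
    then show ?thesis by auto
  qed
  then have "card {T. tubing P (r - Id) T \<and> card T = k} = card {T. tubing P Q T \<and> card T = k}"
    using card_tubings_comparability_graph[OF fin R Q] by simp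
  also have "\<dots> = card {T. tubing P' (r' - Id) T \<and> card T = k}"
    by (rule card_tubings_isomorphic[OF f fin]) (simp add: Q_def)
  finally show ?thesis
    by (simp add: proper_tubing_iff_tubing fin fin' po)
qed

section \<open>Face numbers of the poset associahedron\<close>

text \<open>
  Take a minimal face among those properly containing \<open>F\<close>: a facet of it that contains \<open>F\<close> must be
  \<open>F\<close> itself.
\<close>

lemma facet_of_some_face:
  fixes A :: "'c::euclidean_space set"
  assumes "polytope A" "F face_of A" "F \<noteq> {}" "F \<noteq> A"
  obtains G where "G face_of A" "F facet_of G"
proof -
  define \<G> where "\<G> = {G. G face_of A \<and> F \<subset> G}"
  have "finite \<G>" using finite_polytope_faces[OF assms(1)] by (simp add: \<G>_def)
  moreover have "A \<in> \<G>"
    using face_of_refl[OF polytope_imp_convex] face_of_imp_subset assms by (auto simp: \<G>_def)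
  ultimately obtain G where G: "G \<in> \<G>" "\<forall>H\<in>\<G>. H \<subseteq> G \<longrightarrow> G = H"
    using finite_has_minimal[of \<G>] by auto
  have GA: "G face_of A" "F \<subset> G" using G(1) by (auto simp: \<G>_def)
  have "F face_of G"
    by (rule face_of_subset[OF assms(2)]) (use GA face_of_imp_subset in blast)+
  moreover have "polyhedron G"
    using face_of_polytope_polytope[OF assms(1) GA(1)] polytope_imp_polyhedron by blast
  ultimately obtain H where H: "H facet_of G" "F \<subseteq> H"
    using face_of_polyhedron_subset_facet[of G F] GA(2) assms(3) by blast
  have "H \<noteq> G" using H(1) by (auto simp: facet_of_def)
  moreover have HG: "H face_of G" using H(1) by (simp add: facet_of_def)
  moreover have "H face_of A" by (rule face_of_trans[OF HG GA(1)])
  ultimately have "H \<notin> \<G>" using G(2) face_of_imp_subset[OF HG] by blast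
  then have "F = H" using H(2) \<open>H face_of A\<close> by (auto simp: \<G>_def)
  then show ?thesis using that GA(1) H(1) by blast
qed

lemma proper_tubing_subset:
  assumes "proper_tubing P r T" "U \<subseteq> T"
  shows "proper_tubing P r U"
proof -
  have "tubing_digraph r U \<subseteq> tubing_digraph r T" using assms(2) by (auto simp: tubing_digraph_def)
  then show ?thesis using assms unfolding proper_tubing_def by (meson acyclic_subset subsetD)
qed

text \<open>
  Induction on the number of tubes. The face \<open>F\<close> is a facet of some face \<open>G\<close>, so no face lies
  strictly between them. But adding a single tube of \<open>F\<close> to the tubing of \<open>G\<close> yields a tubing, whose
  face lies between the two and is not \<open>G\<close>; hence the two tubings differ in exactly one tube.
\<close>

lemma aff_dim_face_eq:
  fixes A :: "'c::euclidean_space set"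
  assumes A: "polytope A"
    and \<phi>: "bij_betw \<phi> (nonempty_faces A) {T. proper_tubing P r T}"
    and mono: "\<And>F G. F \<in> nonempty_faces A \<Longrightarrow> G \<in> nonempty_faces A \<Longrightarrow> F \<subseteq> G \<longleftrightarrow> \<phi> G \<subseteq> \<phi> F"
    and fin: "finite P"
    and "F \<in> nonempty_faces A"
  shows "aff_dim F + int (card (\<phi> F)) = aff_dim A"
  using \<open>F \<in> nonempty_faces A\<close>
proof (induction "card (\<phi> F)" arbitrary: F rule: less_induct)
  case less
  note F = \<open>F \<in> nonempty_faces A\<close>
  have tub: "proper_tubing P r (\<phi> G)" if "G \<in> nonempty_faces A" for G
    using that \<phi> by (auto simp: bij_betw_def)
  have fin_tub: "finite T" if "proper_tubing P r T" for T
    by (rule finite_subset[of _ "Pow P"])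
      (use that fin in \<open>auto simp: proper_tubing_def proper_tube_def\<close>)
  have surj: "\<exists>G\<in>nonempty_faces A. \<phi> G = T" if "proper_tubing P r T" for T
    using that \<phi> unfolding bij_betw_def by (metis (mono_tags) imageE mem_Collect_eq)
  have FA: "F face_of A" "F \<noteq> {}" using F by (simp_all add: nonempty_faces_def)
  show ?case
  proof (cases "F = A")
    case True
    obtain G where G: "G \<in> nonempty_faces A" "\<phi> G = {}"
      using surj[OF proper_tubing_subset[OF tub[OF F]], of "{}"] by blast
    then have "G \<subseteq> A" by (auto simp: nonempty_faces_def face_of_imp_subset)
    then have "\<phi> A = {}" using mono[OF G(1)] F True G(2) by blast
    then show ?thesis using True by simp
  next
    case False
    obtain G where G: "G face_of A" "F facet_of G"
      using facet_of_some_face[OF A FA False] by blast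
    then have GF: "F \<subseteq> G" "aff_dim F = aff_dim G - 1"
      by (auto simp: facet_of_def face_of_imp_subset)
    have Gne: "G \<in> nonempty_faces A" using G(1) GF(1) FA(2) by (auto simp: nonempty_faces_def)
    have sub: "\<phi> G \<subseteq> \<phi> F" using mono[OF F Gne] GF(1) by blast
    have "F \<noteq> G" using GF(2) by auto
    then have "\<phi> G \<noteq> \<phi> F" using \<phi> F Gne by (auto simp: bij_betw_def inj_on_def)
    then obtain \<tau> where \<tau>: "\<tau> \<in> \<phi> F" "\<tau> \<notin> \<phi> G" using sub by blast
    have "proper_tubing P r (insert \<tau> (\<phi> G))"
      by (rule proper_tubing_subset[OF tub[OF F]]) (use sub \<tau> in blast)
    then obtain H where H: "H \<in> nonempty_faces A" "\<phi> H = insert \<tau> (\<phi> G)" using surj by blast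
    have "F \<subseteq> H" using mono[OF F H(1)] sub \<tau>(1) unfolding H(2) by simp
    moreover have "H \<subseteq> G" using mono[OF H(1) Gne] unfolding H(2) by blast
    moreover have "H \<noteq> G" using H(2) \<tau> by auto
    ultimately have FH: "F \<subseteq> H" "H \<subset> G" by blast+
    have "H face_of G"
      by (rule face_of_subset[of H A]) (use H(1) FH G(1) face_of_imp_subset in \<open>auto simp: nonempty_faces_def\<close>)
    moreover have "convex G" by (rule face_of_imp_convex[OF G(1)])
    ultimately have "aff_dim H < aff_dim G" using face_of_aff_dim_lt FH(2) by blast
    have "F face_of H"
      by (rule face_of_subset[OF FA(1) FH(1)]) (use H(1) in \<open>auto simp: nonempty_faces_def face_of_imp_subset\<close>)
    have "F = H"
    proof (rule ccontr)
      assume "F \<noteq> H"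
      moreover have "convex H" using H(1) face_of_imp_convex by (auto simp: nonempty_faces_def)
      ultimately have "aff_dim F < aff_dim H" using face_of_aff_dim_lt \<open>F face_of H\<close> by blast
      then show False using \<open>aff_dim H < aff_dim G\<close> GF(2) by linarith
    qed
    then have card: "card (\<phi> F) = Suc (card (\<phi> G))"
      using H(2) \<tau> fin_tub[OF tub[OF Gne]] by simp
    then have "aff_dim G + int (card (\<phi> G)) = aff_dim A" using less.hyps[OF _ Gne] by simp
    then show ?thesis using card GF(2) by simp
  qed
qed

lemma f_vector_poset_associahedron:
  fixes A :: "'c::euclidean_space set"
  assumes "finite P" "card P \<ge> 2" and A: "poset_associahedron P r A"
  shows "f_vector A =
    map (\<lambda>i. card {T. proper_tubing P r T \<and> card T = card P - 2 - i}) [0..<card P - 1]"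
proof -
  have poly: "polytope A" and dim: "aff_dim A = int (card P) - 2"
    using A by (simp_all add: poset_associahedron_def simple_polytope_def)
  obtain \<phi> where \<phi>: "bij_betw \<phi> (nonempty_faces A) {T. proper_tubing P r T}"
    and \<phi>_subset: "\<forall>F\<in>nonempty_faces A. \<forall>G\<in>nonempty_faces A. F \<subseteq> G \<longleftrightarrow> \<phi> G \<subseteq> \<phi> F"
    using A unfolding poset_associahedron_def by (elim conjE exE)
  have mono: "F \<subseteq> G \<longleftrightarrow> \<phi> G \<subseteq> \<phi> F" if "F \<in> nonempty_faces A" "G \<in> nonempty_faces A" for F G
    using \<phi>_subset that by simp
  have dim_face: "aff_dim F + int (card (\<phi> F)) = int (card P) - 2" if "F \<in> nonempty_faces A" for F
    using aff_dim_face_eq[OF poly \<phi> mono assms(1) that] dim by simp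
  have "card {F. F face_of A \<and> aff_dim F = int i} = card {T. proper_tubing P r T \<and> card T = card P - 2 - i}"
    if "i < card P - 1" for i
  proof (rule bij_betw_same_card[of \<phi>])
    have eq: "{F. F face_of A \<and> aff_dim F = int i} = {F \<in> nonempty_faces A. card (\<phi> F) = card P - 2 - i}"
      (is "?L = ?R")
    proof
      show "?L \<subseteq> ?R"
      proof
        fix F assume F: "F \<in> ?L"
        then have "F \<in> nonempty_faces A" by (auto simp: nonempty_faces_def)
        then show "F \<in> ?R" using F dim_face[of F] by auto
      qed
      show "?R \<subseteq> ?L"
      proof
        fix F assume F: "F \<in> ?R"
        then have "aff_dim F = int i" using dim_face[of F] that by auto
        then show "F \<in> ?L" using F by (simp add: nonempty_faces_def)
      qed
    qed
    show "bij_betw \<phi> {F. F face_of A \<and> aff_dim F = int i}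
        {T. proper_tubing P r T \<and> card T = card P - 2 - i}"
      unfolding eq
    proof (rule bij_betw_subset[OF \<phi>])
      have img: "\<phi> ` nonempty_faces A = {T. proper_tubing P r T}"
        using \<phi> by (simp add: bij_betw_def)
      have "\<phi> ` {F \<in> nonempty_faces A. card (\<phi> F) = card P - 2 - i} =
          {T \<in> \<phi> ` nonempty_faces A. card T = card P - 2 - i}" by blast
      then show "\<phi> ` {F \<in> nonempty_faces A. card (\<phi> F) = card P - 2 - i} =
          {T. proper_tubing P r T \<and> card T = card P - 2 - i}" by (simp add: img)
    qed blast
  qed
  moreover have "nat (aff_dim A + 1) = card P - 1" using dim assms(2) by simp
  ultimately show ?thesis by (simp add: f_vector_def)
qed

theorem theorem1p1:
  fixes P :: "'a set" and r :: "'a rel"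
    and P' :: "'b set" and r' :: "'b rel"
    and A :: "'c::euclidean_space set" and A' :: "'d::euclidean_space set"
  assumes "finite_connected_poset P r" and "card P \<ge> 2"
    and "finite_connected_poset P' r'" and "card P' \<ge> 2"
    and "graph_isomorphic P (comparability_graph r) P' (comparability_graph r')"
    and "poset_associahedron P r A" and "poset_associahedron P' r' A'"
  shows "f_vector A = f_vector A'"
proof -
  have P: "finite P" "partial_order_on P r" and P': "finite P'" "partial_order_on P' r'"
    using assms(1,3) by (simp_all add: finite_connected_poset_def)
  have "card P = card P'"
    using assms(5) bij_betw_same_card unfolding graph_isomorphic_def by blast
  then show ?thesis
    using f_vector_poset_associahedron[OF P(1) assms(2,6)] f_vector_poset_associahedron[OF P'(1) assms(4,7)]
      card_proper_tubings_comparability_invariant[OF P(1,2) P'(2) assms(5)] by simp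
qed

end
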